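(* Each of the following $d\times 2d$ equiangular tight frames (ETFs) is switching equivalent to a $2$-circulant $d\times 2d$ ETF: (1) every ETF of type $G_q+1$, where $q$ is an odd prime power (either $q\equiv 1\bmod 4$ or $q\equiv 3\bmod 4$); here $2d=q+1$; (2) every ETF of type $2\cdot G_q$, where $q$ is an odd prime (either $q\equiv 1\bmod 4$ or $q\equiv 3\bmod 4$); here $2d=2q$; (3) every ETF of type $2\cdot(G_q+1)$, where $q$ is an odd prime power (either $q\equiv 1\bmod 4$ or $q\equiv 3\bmod 4$); here $2d=2(q+1)$.
   Context: A $d\times n$ equiangular tight frame (ETF) is a matrix $\Phi\in\mathbb{C}^{d\times n}$ with unit-norm columns such that all off-diagonal entries of $\Phi^*\Phi$ have the same modulus and $\Phi\Phi^*$ is a multiple of the identity. If $n>d$, write $\Phi^*\Phi=I+\gamma S$ with $\gamma>0$ the common off-diagonal modulus; $S$ is the signature matrix of $\Phi$. Two sequences of $n$ vectors in $\mathbb{C}^d$ (columns of $d\times n$ matrices) are switching equivalent if one is obtained from the other by applying a unitary transformation on the left, multiplying the vectors by unimodular scalars, and reindexing the vectors. A $d\times 2d$ matrix $[X\ Y]$ with $X,Y\in\mathbb{C}^{d\times d}$ is $2$-circulant if $X$ and $Y$ are both circulant matrices. Here $I$ is the identity matrix, $J$ the all-ones matrix, $\mathrm{i}=\sqrt{-1}$, and $\chi$ is the quadratic character of $\mathbb{F}_q$: $\chi(0)=0$, $\chi(a)=1$ if $a$ is a nonzero square, and $\chi(a)=-1$ otherwise. Type $G_q+1$ (Paley ETFs).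 For an odd prime power $q$, the Paley conference matrix $C$ is the $(q+1)\times(q+1)$ matrix indexed by $\mathbb{F}_q\cup\{\infty\}$ with $C_{\alpha,\beta}=\chi(\alpha-\beta)$ for $\alpha,\beta\in\mathbb{F}_q$, $C_{\infty,\infty}=0$, $C_{\infty,\beta}=1$ and $C_{\alpha,\infty}=\chi(-1)$. It is symmetric if $q\equiv1\bmod 4$ and skew-symmetric if $q\equiv 3\bmod 4$. Put $\omega=1$ if $q\equiv 1\bmod 4$ and $\omega=\mathrm{i}$ if $q\equiv 3\bmod 4$. An ETF is of type $G_q+1$ if it is a $\frac{q+1}{2}\times(q+1)$ ETF with signature matrix $\omega C$ or $-\omega C$. Type $2\cdot(G_q+1)$. An ETF is of this type if it is a $(q+1)\times 2(q+1)$ ETF with signature matrix \[\begin{bmatrix} S & S+\mathrm{i}I\\ S-\mathrm{i}I & -S\end{bmatrix},\] where $S$ is the signature matrix of an ETF of type $G_q+1$. Type $2\cdot G_q$ with $q\equiv 1\bmod 4$. Let $A$ be the $\{0,1\}$-adjacency matrix of the Paley graph (vertex set $\mathbb{F}_q$, with $\alpha,\beta$ adjacent iff $\chi(\alpha-\beta)=1$), and let $B=J-I-A$. For $\varepsilon\in\{\pm1\}$ put $x=\frac{-1+\sqrt{2q-1}}{q-1}$, $y=\sqrt{1-x^2}$, $\beta=\varepsilon x+\mathrm{i}y$. An ETF is of this type if it is a $q\times 2q$ ETF with signature matrix \[\begin{bmatrix} A-B & \varepsilon I+\beta A+\overline{\beta}B\\ \varepsilon I+\overline{\beta}A+\beta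 B & B-A\end{bmatrix}\] for some $\varepsilon\in\{\pm1\}$. Type $2\cdot G_q$ with $q\equiv 3\bmod 4$. Let $T\in\mathbb{R}^{\mathbb{F}_q\times\mathbb{F}_q}$ be given by $T_{\alpha,\beta}=\chi(\alpha-\beta)$. The matrix $\mathrm{i}T+\frac{1}{\sqrt q}J+\sqrt q\,I$ is a multiple of the Gram matrix of a $\frac{q+1}{2}\times q$ ETF (the Renes--Strohmer ETF), whose signature matrix is $S_0=\frac{1}{\sqrt{q+1}}(\mathrm{i}\sqrt q\,T+J-I)$; its Naimark complement is a $\frac{q-1}{2}\times q$ ETF with signature matrix $-S_0$. For $\sigma,\varepsilon\in\{\pm1\}$ put $S=\sigma S_0$ and $\beta=\frac{2\sigma}{\sqrt{q+1}}+\varepsilon\mathrm{i}\sqrt{1-\frac{4}{q+1}}$. An ETF is of this type if it is a $q\times 2q$ ETF with signature matrix \[\begin{bmatrix} S & S+\beta I\\ S+\overline{\beta}I & -S\end{bmatrix}\] for some $\sigma,\varepsilon\in\{\pm1\}$. *)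

theory Defs
  imports
    Complex_Main
    "HOL-Library.Cardinality"
    "HOL-Computational_Algebra.Primes"
    "Jordan_Normal_Form.Schur_Decomposition"
begin

definition is_etf :: "nat \<Rightarrow> nat \<Rightarrow> complex mat \<Rightarrow> bool" where
  "is_etf d n \<Phi> \<longleftrightarrow>
     \<Phi> \<in> carrier_mat d n \<and>
     (\<forall>j<n. col \<Phi> j \<bullet>c col \<Phi> j = 1) \<and>
     (\<exists>\<gamma>. \<forall>i<n. \<forall>j<n. i \<noteq> j \<longrightarrow> cmod ((mat_adjoint \<Phi> * \<Phi>) $$ (i, j)) = \<gamma>) \<and>
     (\<exists>c. \<Phi> * mat_adjoint \<Phi> = c \<cdot>\<^sub>m 1\<^sub>m d)"

definition has_signature :: "nat \<Rightarrow> nat \<Rightarrow> complex mat \<Rightarrow> complex mat \<Rightarrow> bool" where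
  "has_signature d n \<Phi> S \<longleftrightarrow>
     d < n \<and> S \<in> carrier_mat n n \<and>
     (\<exists>\<gamma>>0. (\<forall>i<n. \<forall>j<n. i \<noteq> j \<longrightarrow> cmod ((mat_adjoint \<Phi> * \<Phi>) $$ (i, j)) = \<gamma>) \<and>
            mat_adjoint \<Phi> * \<Phi> = 1\<^sub>m n + complex_of_real \<gamma> \<cdot>\<^sub>m S)"

definition is_unitary :: "nat \<Rightarrow> complex mat \<Rightarrow> bool" where
  "is_unitary d U \<longleftrightarrow>
     U \<in> carrier_mat d d \<and> mat_adjoint U * U = 1\<^sub>m d \<and> U * mat_adjoint U = 1\<^sub>m d"

definition switching_equivalent :: "nat \<Rightarrow> nat \<Rightarrow> complex mat \<Rightarrow> complex mat \<Rightarrow> bool" where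
  "switching_equivalent d n \<Phi> \<Psi> \<longleftrightarrow>
     \<Phi> \<in> carrier_mat d n \<and> \<Psi> \<in> carrier_mat d n \<and>
     (\<exists>U c \<pi>. is_unitary d U \<and> (\<forall>j<n. cmod (c j) = 1) \<and> bij_betw \<pi> {..<n} {..<n} \<and>
        (\<forall>j<n. col \<Psi> j = c j \<cdot>\<^sub>v (U *\<^sub>v col \<Phi> (\<pi> j))))"

text \<open>Each row is the previous one shifted cyclically one place to the right.\<close>

definition is_circulant :: "nat \<Rightarrow> complex mat \<Rightarrow> bool" where
  "is_circulant d X \<longleftrightarrow>
     X \<in> carrier_mat d d \<and>
     (\<exists>x :: nat \<Rightarrow> complex. \<forall>i<d. \<forall>j<d. X $$ (i, j) = x ((j + d - i) mod d))"

definition is_2circulant :: "nat \<Rightarrow> complex mat \<Rightarrow> bool" where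
  "is_2circulant d \<Psi> \<longleftrightarrow>
     (\<exists>X Y. is_circulant d X \<and> is_circulant d Y \<and>
        \<Psi> = mat d (2 * d) (\<lambda>(i, j). if j < d then X $$ (i, j) else Y $$ (i, j - d)))"

definition quad_char :: "'a :: field \<Rightarrow> complex" where
  "quad_char a = (if a = 0 then 0 else if \<exists>b. a = b ^ 2 then 1 else - 1)"

text \<open>
  The field with \<open>q\<close> elements is a type \<open>'a\<close> of class \<open>field\<close> and \<open>finite\<close> with
  \<open>CARD('a) = q\<close>; such a \<open>q\<close> is always a prime power.
  Matrices indexed by \<open>'a\<close>, or by \<open>'a option\<close> with \<open>None\<close> playing the role of
  \<open>\<infinity>\<close>, are written with respect to an enumeration \<open>e\<close> of the index set. Being of one
  of the types below means having the required signature for some enumeration.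
\<close>

fun paley_conference_entry :: "'a :: field option \<Rightarrow> 'a option \<Rightarrow> complex" where
  "paley_conference_entry (Some a) (Some b) = quad_char (a - b)"
| "paley_conference_entry None None = 0"
| "paley_conference_entry None (Some b) = 1"
| "paley_conference_entry (Some a) None = quad_char (- 1 :: 'a)"

definition paley_conference_mat :: "(nat \<Rightarrow> 'a :: {field, finite} option) \<Rightarrow> complex mat" where
  "paley_conference_mat e =
     mat (CARD('a) + 1) (CARD('a) + 1) (\<lambda>(i, j). paley_conference_entry (e i) (e j))"

definition paley_omega :: "nat \<Rightarrow> complex" where
  "paley_omega q = (if q mod 4 = 1 then 1 else \<i>)"

definition etf_type_G_plus_1 :: "'a :: {field, finite} itself \<Rightarrow> complex mat \<Rightarrow> bool" where
  "etf_type_G_plus_1 (F :: 'a itself) \<Phi> \<longleftrightarrow>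
     (let q = CARD('a) in
        is_etf ((q + 1) div 2) (q + 1) \<Phi> \<and>
        (\<exists>(e :: nat \<Rightarrow> 'a option) s. bij_betw e {..<q + 1} UNIV \<and> s \<in> {1, - 1} \<and>
           has_signature ((q + 1) div 2) (q + 1) \<Phi>
             ((s * paley_omega q) \<cdot>\<^sub>m paley_conference_mat e)))"

definition etf_type_2_G_plus_1 :: "'a :: {field, finite} itself \<Rightarrow> complex mat \<Rightarrow> bool" where
  "etf_type_2_G_plus_1 (F :: 'a itself) \<Phi> \<longleftrightarrow>
     (let q = CARD('a); m = q + 1 in
        is_etf m (2 * m) \<Phi> \<and>
        (\<exists>\<Phi>\<^sub>0 S. etf_type_G_plus_1 TYPE('a) \<Phi>\<^sub>0 \<and> has_signature (m div 2) m \<Phi>\<^sub>0 S \<and>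
           has_signature m (2 * m) \<Phi>
             (four_block_mat S (S + \<i> \<cdot>\<^sub>m 1\<^sub>m m) (S - \<i> \<cdot>\<^sub>m 1\<^sub>m m) (- S))))"

definition ones_mat :: "nat \<Rightarrow> complex mat" where
  "ones_mat n = mat n n (\<lambda>_. 1)"

definition paley_adjacency_mat :: "(nat \<Rightarrow> 'a :: {field, finite}) \<Rightarrow> complex mat" where
  "paley_adjacency_mat e =
     mat CARD('a) CARD('a) (\<lambda>(i, j). if quad_char (e i - e j) = 1 then 1 else 0)"

definition etf_type_2_G_mod1 :: "'a :: {field, finite} itself \<Rightarrow> complex mat \<Rightarrow> bool" where
  "etf_type_2_G_mod1 (F :: 'a itself) \<Phi> \<longleftrightarrow>
     (let q = CARD('a) in
        q mod 4 = 1 \<and> is_etf q (2 * q) \<Phi> \<and>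
        (\<exists>(e :: nat \<Rightarrow> 'a) \<epsilon> :: real. bij_betw e {..<q} UNIV \<and> \<epsilon> \<in> {1, - 1} \<and>
           (let A = paley_adjacency_mat e;
                B = ones_mat q - 1\<^sub>m q - A;
                x = (- 1 + sqrt (2 * real q - 1)) / (real q - 1);
                y = sqrt (1 - x\<^sup>2);
                \<beta> = Complex (\<epsilon> * x) y
            in has_signature q (2 * q) \<Phi>
                 (four_block_mat
                    (A - B) (complex_of_real \<epsilon> \<cdot>\<^sub>m 1\<^sub>m q + \<beta> \<cdot>\<^sub>m A + cnj \<beta> \<cdot>\<^sub>m B)
                    (complex_of_real \<epsilon> \<cdot>\<^sub>m 1\<^sub>m q + cnj \<beta> \<cdot>\<^sub>m A + \<beta> \<cdot>\<^sub>m B) (B - A)))))"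

definition paley_char_mat :: "(nat \<Rightarrow> 'a :: {field, finite}) \<Rightarrow> complex mat" where
  "paley_char_mat e = mat CARD('a) CARD('a) (\<lambda>(i, j). quad_char (e i - e j))"

text \<open>The signature matrix of the Renes--Strohmer equiangular tight frame.\<close>

definition renes_strohmer_mat :: "(nat \<Rightarrow> 'a :: {field, finite}) \<Rightarrow> complex mat" where
  "renes_strohmer_mat e =
     (let q = CARD('a) in
        complex_of_real (1 / sqrt (real q + 1)) \<cdot>\<^sub>m
          ((\<i> * complex_of_real (sqrt (real q))) \<cdot>\<^sub>m paley_char_mat e + ones_mat q - 1\<^sub>m q))"

definition etf_type_2_G_mod3 :: "'a :: {field, finite} itself \<Rightarrow> complex mat \<Rightarrow> bool" where
  "etf_type_2_G_mod3 (F :: 'a itself) \<Phi> \<longleftrightarrow>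
     (let q = CARD('a) in
        q mod 4 = 3 \<and> is_etf q (2 * q) \<Phi> \<and>
        (\<exists>(e :: nat \<Rightarrow> 'a) (\<sigma> :: real) \<epsilon> :: real.
           bij_betw e {..<q} UNIV \<and> \<sigma> \<in> {1, - 1} \<and> \<epsilon> \<in> {1, - 1} \<and>
           (let S = complex_of_real \<sigma> \<cdot>\<^sub>m renes_strohmer_mat e;
                \<beta> = Complex (2 * \<sigma> / sqrt (real q + 1)) (\<epsilon> * sqrt (1 - 4 / (real q + 1)))
            in has_signature q (2 * q) \<Phi>
                 (four_block_mat S (S + \<beta> \<cdot>\<^sub>m 1\<^sub>m q) (S + cnj \<beta> \<cdot>\<^sub>m 1\<^sub>m q) (- S)))))"

definition etf_type_2_G :: "'a :: {field, finite} itself \<Rightarrow> complex mat \<Rightarrow> bool" where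
  "etf_type_2_G (F :: 'a itself) \<Phi> \<longleftrightarrow>
     etf_type_2_G_mod1 TYPE('a) \<Phi> \<or> etf_type_2_G_mod3 TYPE('a) \<Phi>"

definition equivalent_to_2circulant_etf :: "nat \<Rightarrow> complex mat \<Rightarrow> bool" where
  "equivalent_to_2circulant_etf d \<Phi> \<longleftrightarrow>
     (\<exists>\<Psi>. is_etf d (2 * d) \<Psi> \<and> is_2circulant d \<Psi> \<and> switching_equivalent d (2 * d) \<Phi> \<Psi>)"

end

theory Submission
  imports Defs "HOL-Number_Theory.Residues"
begin

text \<open>
  If the signature matrix can be permuted and switched into
  \<open>[[A, B], [B\<^sup>*, -A]]\<close> with \<open>A\<close>, \<open>B\<close> circulant, then the Fourier transform decomposes the Gram
  matrix into \<open>2 \<times> 2\<close> blocks. Each is twice a projection of trace \<open>1\<close>, hence of rank one, and rank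
  one factorizations of the blocks are the eigenvalues of the two circulant halves of a frame with the
  same Gram matrix; frames with equal Gram matrices differ by a unitary.

  It remains to bring the signature matrices into this form. For type \<open>2\<cdot>G\<^sub>q\<close> with \<open>q\<close> prime the
  enumeration \<open>0, 1, \<dots>, q - 1\<close> of the field does it. For the Paley conference matrix, take the
  projective line to be the quotient of the multiplicative group of the field with \<open>q\<^sup>2\<close>
  elements by the one of \<open>\<F>\<^sub>q\<close>; the entries are quadratic characters of determinants.
  Multiplication by a generator is a cyclic permutation of the \<open>q + 1\<close> points and negates the
  matrix, as the norm of the generator is a nonsquare. So its square has two orbits, on which the
  diagonal blocks are opposite and circulant up to scalar weights.
\<close>

section \<open>Circulant matrices and the discrete Fourier transform\<close>

text \<open>Exponents are naturals; the inverse of a root of unity is always written as its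
  conjugate, so no negative exponents occur.\<close>

definition unit_root :: "nat \<Rightarrow> nat \<Rightarrow> complex" where
  "unit_root d k = cis (2 * pi * real k / real d)"

lemma unit_root_add: "unit_root d (k + l) = unit_root d k * unit_root d l"
  by (simp add: unit_root_def cis_mult add_divide_distrib distrib_left)

lemma unit_root_mult: "unit_root d (k * l) = unit_root d k ^ l"
  by (induction l) (simp_all add: unit_root_add, simp add: unit_root_def)

lemma unit_root_0 [simp]: "unit_root d 0 = 1"
  by (simp add: unit_root_def)

lemma unit_root_self [simp]: "unit_root d d = 1"
  by (cases "d = 0") (simp_all add: unit_root_def)

lemma unit_root_cnj [simp]: "unit_root d k * cnj (unit_root d k) = 1"
  by (simp add: unit_root_def cis_cnj cis_mult)

lemma unit_root_mod: "unit_root d (k * (l mod d)) = unit_root d (k * l)"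
proof -
  have "unit_root d (k * l) = unit_root d (k * (l mod d) + d * (k * (l div d)))"
    by (rule arg_cong[of _ _ "unit_root d"]) (metis add.commute distrib_left mult.left_commute mult_div_mod_eq)
  also have "\<dots> = unit_root d (k * (l mod d))"
    by (subst unit_root_add) (simp add: unit_root_mult)
  finally show ?thesis ..
qed

lemma sum_unit_root:
  assumes "k < d" "l < d"
  shows "(\<Sum>m<d. unit_root d (k * m) * cnj (unit_root d (l * m))) = (if k = l then of_nat d else 0)"
proof (cases "k = l")
  case True
  then show ?thesis by simp
next
  case False
  \<comment> \<open>Orthogonality is the geometric series in the ratio of the two roots, which
    differs from 1 because \<open>k\<close> and \<open>l\<close> are distinct and below
    \<open>d\<close>.\<close>
  define z where "z = unit_root d k * cnj (unit_root d l)"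
  have "unit_root d k \<noteq> unit_root d l"
    using bij_betw_imp_inj_on[OF bij_betw_roots_unity[of d]] assms False
    unfolding inj_on_def unit_root_def by auto
  moreover have "z * unit_root d l = unit_root d k"
    unfolding z_def using unit_root_cnj[of d l] by (simp add: mult.assoc mult.commute[of "cnj _"])
  ultimately have "z \<noteq> 1"
    by auto
  moreover have "z ^ d = 1"
    by (simp add: z_def power_mult_distrib flip: complex_cnj_power unit_root_mult)
       (simp add: mult.commute[of _ d] unit_root_mult)
  moreover have "(\<Sum>m<d. unit_root d (k * m) * cnj (unit_root d (l * m))) = (\<Sum>m<d. z ^ m)"
    by (simp add: z_def power_mult_distrib unit_root_mult)
  ultimately show ?thesis
    using False by (simp add: geometric_sum)
qed

text \<open>The circulant matrix with eigenvalues \<open>u 0, \<dots>, u (d - 1)\<close>.\<close>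

definition circ :: "nat \<Rightarrow> (nat \<Rightarrow> complex) \<Rightarrow> nat \<Rightarrow> nat \<Rightarrow> complex" where
  "circ d u i j = (\<Sum>k<d. u k * unit_root d (k * i) * cnj (unit_root d (k * j))) / of_nat d"

text \<open>A circulant is kept as a function on all pairs of naturals. The two identities can then
  be checked without truncated subtraction or remainders.\<close>

definition circulant_fun :: "nat \<Rightarrow> (nat \<Rightarrow> nat \<Rightarrow> complex) \<Rightarrow> bool" where
  "circulant_fun d f \<longleftrightarrow> (\<forall>i j. f (Suc i) (Suc j) = f i j) \<and> (\<forall>i j. f i (j + d) = f i j)"

lemma circulant_fun_eq:
  assumes "circulant_fun d f" "i \<le> d"
  shows "f i j = f 0 ((j + d - i) mod d)"
proof -
  have shift: "f (k + a) (k + b) = f a b" for k a b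
    using assms(1) by (induction k) (simp_all add: circulant_fun_def)
  have period: "f a (b + d * k) = f a b" for a b k
    using assms(1) by (induction k) (simp_all add: circulant_fun_def add.assoc[symmetric] add.commute[of d])
  \<comment> \<open>One period is added first, so that subtracting \<open>i\<close>, which is at
    most \<open>d\<close>, does not truncate.\<close>
  have "f i j = f i (j + d)"
    using assms(1) by (simp add: circulant_fun_def)
  also have "\<dots> = f 0 (j + d - i)"
    using shift[of i 0 "j + d - i"] assms(2) by simp
  also have "\<dots> = f 0 ((j + d - i) mod d)"
    using period[of 0 "(j + d - i) mod d" "(j + d - i) div d"] by simp
  finally show ?thesis .
qed

lemma is_circulant_mat:
  assumes "circulant_fun d f"
  shows "is_circulant d (mat d d (\<lambda>(i, j). f i j))"
  unfolding is_circulant_def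
  by (intro conjI exI[of _ "f 0"]) (auto intro: circulant_fun_eq[OF assms])

lemma circulant_fun_circ: "circulant_fun d (circ d u)"
proof -
  have "circ d u (Suc i) (Suc j) = circ d u i j" for i j
  proof -
    have "u k * unit_root d (k * Suc i) * cnj (unit_root d (k * Suc j))
        = u k * unit_root d (k * i) * cnj (unit_root d (k * j))" for k
    proof -
      have "u k * unit_root d (k * Suc i) * cnj (unit_root d (k * Suc j))
        = u k * unit_root d (k * i) * cnj (unit_root d (k * j)) * (unit_root d k * cnj (unit_root d k))"
        by (simp only: mult_Suc_right unit_root_add complex_cnj_mult mult_ac)
      then show ?thesis
        by simp
    qed
    then show ?thesis
      unfolding circ_def by (simp only:)
  qed
  moreover have "unit_root d (k * (j + d)) = unit_root d (k * j)" for k j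
    using unit_root_mod[of d k "j + d"] unit_root_mod[of d k j] by simp
  ultimately show ?thesis
    by (simp add: circulant_fun_def circ_def)
qed

lemma cnj_circ: "cnj (circ d u i j) = circ d (\<lambda>k. cnj (u k)) j i"
  by (simp add: circ_def mult_ac)

text \<open>All circulants share the Fourier basis as eigenvectors, so a product multiplies
  eigenvalues. In the computation, orthogonality removes the terms with \<open>k\<close> different
  from \<open>k'\<close>.\<close>

lemma circ_mult: "(\<Sum>l<d. circ d u i l * circ d v l j) = circ d (\<lambda>k. u k * v k) i j"
proof -
  define a where "a k = u k * unit_root d (k * i)" for k
  define b where "b k = v k * cnj (unit_root d (k * j))" for k
  have "(\<Sum>l<d. circ d u i l * circ d v l j) =
      (\<Sum>l<d. \<Sum>k'<d. \<Sum>k<d. a k * b k' * (unit_root d (k' * l) * cnj (unit_root d (k * l)))) / (of_nat d)\<^sup>2"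
    by (simp add: circ_def a_def b_def sum_product sum_divide_distrib power2_eq_square mult_ac)
       (intro sum.cong refl sum.swap)
  also have "(\<Sum>l<d. \<Sum>k'<d. \<Sum>k<d. a k * b k' * (unit_root d (k' * l) * cnj (unit_root d (k * l))))
      = (\<Sum>k'<d. \<Sum>k<d. a k * b k' * (\<Sum>l<d. unit_root d (k' * l) * cnj (unit_root d (k * l))))"
    by (subst sum.swap, rule sum.cong[OF refl], subst sum.swap) (simp add: sum_distrib_left)
  also have "\<dots> = (\<Sum>k'<d. \<Sum>k<d. if k = k' then a k * b k' * of_nat d else 0)"
    by (intro sum.cong refl) (simp add: sum_unit_root)
  also have "\<dots> = (\<Sum>k<d. a k * b k) * of_nat d"
    by (simp add: sum_distrib_right)
  finally show ?thesis
    by (cases "d = 0") (simp_all add: circ_def a_def b_def power2_eq_square mult_ac)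
qed

text \<open>The Fourier transform of the first row recovers the eigenvalues. This turns an identity
  between circulants into one identity per Fourier mode.\<close>

lemma circ_inject:
  assumes "\<And>j. j < d \<Longrightarrow> circ d u 0 j = circ d v 0 j" "k < d"
  shows "u k = v k"
proof -
  have recover: "(\<Sum>j<d. circ d u 0 j * unit_root d (k * j)) = u k" for u
  proof -
    have "(\<Sum>j<d. circ d u 0 j * unit_root d (k * j)) =
       (\<Sum>j<d. \<Sum>l<d. u l * (unit_root d (k * j) * cnj (unit_root d (l * j)))) / of_nat d"
      by (simp add: circ_def sum_divide_distrib sum_distrib_left sum_distrib_right mult_ac)
    also have "(\<Sum>j<d. \<Sum>l<d. u l * (unit_root d (k * j) * cnj (unit_root d (l * j))))
       = (\<Sum>l<d. u l * (\<Sum>j<d. unit_root d (k * j) * cnj (unit_root d (l * j))))"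
      by (subst sum.swap) (simp add: sum_distrib_left)
    also have "\<dots> = (\<Sum>l<d. if l = k then u k * of_nat d else 0)"
      using assms(2) by (intro sum.cong refl) (simp add: sum_unit_root)
    finally show ?thesis
      using assms(2) by simp
  qed
  have "(\<Sum>j<d. circ d u 0 j * unit_root d (k * j)) = (\<Sum>j<d. circ d v 0 j * unit_root d (k * j))"
    using assms(1) by simp
  then show ?thesis
    by (simp only: recover)
qed

lemma circ_const:
  assumes "i < d" "j < d"
  shows "circ d (\<lambda>_. c) i j = (if i = j then c else 0)"
proof -
  have "circ d (\<lambda>_. c) i j = c * (\<Sum>k<d. unit_root d (i * k) * cnj (unit_root d (j * k))) / of_nat d"
    by (simp add: circ_def sum_distrib_left mult_ac)
  then show ?thesis
    using assms by (simp add: sum_unit_root)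
qed

lemma circulant_fun_imp_circ:
  assumes "circulant_fun d f"
  shows "\<exists>u. \<forall>i<d. \<forall>j<d. f i j = circ d u i j"
proof (intro exI allI impI)
  fix i j assume ij: "i < d" "j < d"
  \<comment> \<open>The eigenvalues are the Fourier transform of the first row; \<open>*\<close>
    then locates the one term that survives orthogonality.\<close>
  let ?u = "\<lambda>k. \<Sum>m<d. f 0 m * unit_root d (k * m)"
  have *: "j = (m + i) mod d \<longleftrightarrow> m = (j + d - i) mod d" if "m < d" for m
  proof -
    have "(m + i) mod d = (if m + i < d then m + i else m + i - d)"
      using that ij by (simp add: mod_if)
    moreover have "(j + d - i) mod d = (if i \<le> j then j - i else j + d - i)"
      using ij by (auto simp: mod_if)
    ultimately show ?thesis
      using that ij by auto
  qed
  have "circ d ?u i j = (\<Sum>k<d. \<Sum>m<d. f 0 m * (unit_root d ((m + i) mod d * k) * cnj (unit_root d (j * k)))) / of_nat d"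
    unfolding circ_def
    by (simp only: sum_distrib_right mult.commute[of _ "_ :: nat"] unit_root_mod)
       (simp add: unit_root_add distrib_left mult_ac)
  also have "(\<Sum>k<d. \<Sum>m<d. f 0 m * (unit_root d ((m + i) mod d * k) * cnj (unit_root d (j * k))))
      = (\<Sum>m<d. f 0 m * (\<Sum>k<d. unit_root d ((m + i) mod d * k) * cnj (unit_root d (j * k))))"
    by (subst sum.swap) (simp add: sum_distrib_left)
  also have "\<dots> = (\<Sum>m<d. if m = (j + d - i) mod d then f 0 m * of_nat d else 0)"
    using ij by (intro sum.cong refl) (auto simp: sum_unit_root simp flip: *)
  also have "\<dots> = f 0 ((j + d - i) mod d) * of_nat d"
    using ij by simp
  finally show "f i j = circ d ?u i j"
    using ij circulant_fun_eq[OF assms, of i j] by simp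
qed

section \<open>Frames with circulant Gram blocks\<close>

lemma mat_adjoint_dim [simp]:
  "dim_row (mat_adjoint A) = dim_col A" "dim_col (mat_adjoint A) = dim_row A"
  by (simp_all add: mat_adjoint_def mat_of_rows_def)

lemma mat_adjoint_carrier: "A \<in> carrier_mat n m \<Longrightarrow> mat_adjoint A \<in> carrier_mat m n"
  by (intro carrier_matI) auto

lemma mat_adjoint_index:
  assumes "A \<in> carrier_mat n m" "i < m" "j < n"
  shows "mat_adjoint A $$ (i, j) = cnj (A $$ (j, i))"
  using assms by (auto simp: mat_adjoint_def mat_of_rows_def)

lemma mat_adjoint_mult_index:
  assumes "A \<in> carrier_mat n m" "B \<in> carrier_mat n k" "i < m" "j < k"
  shows "(mat_adjoint A * B) $$ (i, j) = (\<Sum>l<n. cnj (A $$ (l, i)) * B $$ (l, j))"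
proof -
  have "(mat_adjoint A * B) $$ (i, j) = (\<Sum>l = 0..<n. mat_adjoint A $$ (i, l) * B $$ (l, j))"
    using assms by (auto simp: scalar_prod_def)
  also have "\<dots> = (\<Sum>l<n. cnj (A $$ (l, i)) * B $$ (l, j))"
    unfolding lessThan_atLeast0
    by (rule sum.cong[OF refl]) (simp add: mat_adjoint_index[OF assms(1) assms(3)])
  finally show ?thesis .
qed

lemma mult_mat_adjoint_index:
  assumes "A \<in> carrier_mat n m" "B \<in> carrier_mat k m" "i < n" "j < k"
  shows "(A * mat_adjoint B) $$ (i, j) = (\<Sum>l<m. A $$ (i, l) * cnj (B $$ (j, l)))"
proof -
  have "(A * mat_adjoint B) $$ (i, j) = (\<Sum>l = 0..<m. A $$ (i, l) * mat_adjoint B $$ (l, j))"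
    using assms by (auto simp: scalar_prod_def)
  also have "\<dots> = (\<Sum>l<m. A $$ (i, l) * cnj (B $$ (j, l)))"
    unfolding lessThan_atLeast0
    by (rule sum.cong[OF refl]) (simp add: mat_adjoint_index[OF assms(2) _ assms(4)])
  finally show ?thesis .
qed

lemma mat_adjoint_mult_adjoint:
  fixes A B :: "complex mat"
  assumes "A \<in> carrier_mat n m" "B \<in> carrier_mat k m"
  shows "mat_adjoint (A * mat_adjoint B) = B * mat_adjoint A"
proof (rule eq_matI)
  have AB: "A * mat_adjoint B \<in> carrier_mat n k"
    using assms by auto
  show "dim_row (mat_adjoint (A * mat_adjoint B)) = dim_row (B * mat_adjoint A)"
    "dim_col (mat_adjoint (A * mat_adjoint B)) = dim_col (B * mat_adjoint A)"
    using assms by auto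
  fix i j assume "i < dim_row (B * mat_adjoint A)" "j < dim_col (B * mat_adjoint A)"
  then have "i < k" "j < n"
    using assms by auto
  then show "mat_adjoint (A * mat_adjoint B) $$ (i, j) = (B * mat_adjoint A) $$ (i, j)"
    by (simp only: mat_adjoint_index[OF AB] mult_mat_adjoint_index[OF assms]
        mult_mat_adjoint_index[OF assms(2,1)]) (simp add: mult.commute)
qed

lemma mat_adjoint_smult:
  fixes A :: "complex mat"
  assumes "A \<in> carrier_mat n m"
  shows "mat_adjoint (c \<cdot>\<^sub>m A) = cnj c \<cdot>\<^sub>m mat_adjoint A"
proof (rule eq_matI)
  have cA: "c \<cdot>\<^sub>m A \<in> carrier_mat n m"
    using assms by simp
  fix i j assume "i < dim_row (cnj c \<cdot>\<^sub>m mat_adjoint A)" "j < dim_col (cnj c \<cdot>\<^sub>m mat_adjoint A)"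
  then have "i < m" "j < n"
    using assms by auto
  then show "mat_adjoint (c \<cdot>\<^sub>m A) $$ (i, j) = (cnj c \<cdot>\<^sub>m mat_adjoint A) $$ (i, j)"
    using assms by (auto simp: mat_adjoint_index[OF cA] mat_adjoint_index[OF assms])
qed auto

text \<open>If \<open>\<Psi> = U * \<Phi>\<close> with \<open>U\<close> unitary, then
  \<open>\<Phi>\<close> has the same frame constant \<open>c\<close>, and multiplying by the adjoint
  of \<open>\<Phi>\<close> gives \<open>c\<close> times \<open>U\<close>. This dictates the
  definition of \<open>U\<close>; equality of the Gram matrices shows that it works.\<close>

lemma unitary_of_equal_gram:
  assumes \<Phi>: "\<Phi> \<in> carrier_mat d n" and \<Psi>: "\<Psi> \<in> carrier_mat d n"
    and gram: "mat_adjoint \<Phi> * \<Phi> = mat_adjoint \<Psi> * \<Psi>"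
    and frame: "\<Psi> * mat_adjoint \<Psi> = complex_of_real c \<cdot>\<^sub>m 1\<^sub>m d" and c: "c \<noteq> 0"
  obtains U where "is_unitary d U" "\<Psi> = U * \<Phi>"
proof
  define U where "U = complex_of_real (1 / c) \<cdot>\<^sub>m (\<Psi> * mat_adjoint \<Phi>)"
  note a\<Phi> = mat_adjoint_carrier[OF \<Phi>] and a\<Psi> = mat_adjoint_carrier[OF \<Psi>]
  have \<Psi>\<Phi>: "\<Psi> * mat_adjoint \<Phi> \<in> carrier_mat d d" and \<Phi>\<Psi>: "\<Phi> * mat_adjoint \<Psi> \<in> carrier_mat d d"
    using \<Phi> \<Psi> a\<Phi> a\<Psi> by auto
  have U: "U \<in> carrier_mat d d"
    using \<Psi>\<Phi> by (simp add: U_def)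
  have adj_U: "mat_adjoint U = complex_of_real (1 / c) \<cdot>\<^sub>m (\<Phi> * mat_adjoint \<Psi>)"
    unfolding U_def mat_adjoint_smult[OF \<Psi>\<Phi>] mat_adjoint_mult_adjoint[OF \<Psi> \<Phi>] by simp
  have *: "\<Psi> * mat_adjoint \<Phi> * \<Phi> = complex_of_real c \<cdot>\<^sub>m \<Psi>"
  proof -
    have "\<Psi> * mat_adjoint \<Phi> * \<Phi> = \<Psi> * (mat_adjoint \<Phi> * \<Phi>)"
      by (rule assoc_mult_mat[OF \<Psi> a\<Phi> \<Phi>])
    also have "\<dots> = \<Psi> * mat_adjoint \<Psi> * \<Psi>"
      unfolding gram by (rule assoc_mult_mat[OF \<Psi> a\<Psi> \<Psi>, symmetric])
    also have "\<dots> = complex_of_real c \<cdot>\<^sub>m \<Psi>"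
      unfolding frame using \<Psi> by (simp add: mult_smult_assoc_mat[of _ d d _ n])
    finally show ?thesis .
  qed
  show U\<Phi>: "\<Psi> = U * \<Phi>"
    unfolding U_def mult_smult_assoc_mat[OF \<Psi>\<Phi> \<Phi>] *
    using c by (intro eq_matI) auto
  have "U * mat_adjoint U = complex_of_real (1 / c) \<cdot>\<^sub>m (U * (\<Phi> * mat_adjoint \<Psi>))"
    unfolding adj_U by (rule mult_smult_distrib[OF U \<Phi>\<Psi>])
  also have "U * (\<Phi> * mat_adjoint \<Psi>) = \<Psi> * mat_adjoint \<Psi>"
    by (simp only: assoc_mult_mat[OF U \<Phi> a\<Psi>, symmetric] U\<Phi>[symmetric])
  also have "complex_of_real (1 / c) \<cdot>\<^sub>m (\<Psi> * mat_adjoint \<Psi>) = 1\<^sub>m d"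
    unfolding frame using c by (intro eq_matI) auto
  finally have UU: "U * mat_adjoint U = 1\<^sub>m d" .
  moreover have "mat_adjoint U * U = 1\<^sub>m d"
    by (rule mat_mult_left_right_inverse[OF U mat_adjoint_carrier[OF U] UU])
  ultimately show "is_unitary d U"
    using U by (simp add: is_unitary_def)
qed

text \<open>Compare traces: \<open>d\<close> times the constant equals the sum of the squared norms
  of the \<open>2 * d\<close> unit columns.\<close>

lemma etf_frame_constant:
  assumes etf: "is_etf d (2 * d) \<Phi>" and d: "d > 0"
  shows "\<Phi> * mat_adjoint \<Phi> = 2 \<cdot>\<^sub>m 1\<^sub>m d"
proof -
  from etf have \<Phi>: "\<Phi> \<in> carrier_mat d (2 * d)"
    and norm: "\<And>j. j < 2 * d \<Longrightarrow> col \<Phi> j \<bullet>c col \<Phi> j = 1"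
    by (auto simp: is_etf_def)
  from etf obtain c where c: "\<Phi> * mat_adjoint \<Phi> = c \<cdot>\<^sub>m 1\<^sub>m d"
    by (auto simp: is_etf_def)
  have "of_nat d * c = (\<Sum>i<d. (\<Phi> * mat_adjoint \<Phi>) $$ (i, i))"
    by (simp add: c)
  also have "\<dots> = (\<Sum>i<d. \<Sum>l<2 * d. \<Phi> $$ (i, l) * cnj (\<Phi> $$ (i, l)))"
    by (intro sum.cong refl) (simp add: mult_mat_adjoint_index[OF \<Phi> \<Phi>])
  also have "\<dots> = (\<Sum>l<2 * d. \<Sum>i<d. \<Phi> $$ (i, l) * cnj (\<Phi> $$ (i, l)))"
    by (rule sum.swap)
  also have "\<dots> = (\<Sum>l<2 * d. col \<Phi> l \<bullet>c col \<Phi> l)"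
    using \<Phi> by (intro sum.cong refl) (simp add: scalar_prod_def lessThan_atLeast0)
  also have "\<dots> = of_nat d * 2"
    by (simp add: norm)
  finally have "c = 2"
    using d by simp
  with c show ?thesis by simp
qed

text \<open>For each Fourier mode the Gram matrix is twice a projection of rank one, given by
  \<open>\<alpha>\<close>, \<open>\<beta>\<close> and \<open>2 - \<alpha>\<close>.\<close>

lemma rank_one_factor:
  fixes \<alpha> \<beta> :: complex
  assumes "\<alpha> * cnj \<alpha> + \<beta> * cnj \<beta> = 2 * \<alpha>"
  shows "\<exists>x y. cnj x * x = \<alpha> \<and> cnj x * y = \<beta> \<and> cnj y * y = 2 - \<alpha>"
proof -
  \<comment> \<open>By hypothesis \<open>2 * \<alpha>\<close> is a sum of two squared moduli, so
    \<open>\<alpha>\<close> is the nonnegative real \<open>a\<close>.\<close>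
  define a where "a = ((cmod \<alpha>)\<^sup>2 + (cmod \<beta>)\<^sup>2) / 2"
  have \<alpha>: "\<alpha> = complex_of_real a"
    using assms by (simp add: a_def complex_norm_square del: of_real_power)
  then have "(cmod \<alpha>)\<^sup>2 = a\<^sup>2"
    by simp
  moreover have "2 * a = (cmod \<alpha>)\<^sup>2 + (cmod \<beta>)\<^sup>2"
    by (simp add: a_def)
  ultimately have b: "(cmod \<beta>)\<^sup>2 = a * (2 - a)"
    by (simp add: right_diff_distrib power2_eq_square)
  have a: "a \<ge> 0"
    by (simp add: a_def)
  show ?thesis
  proof (cases "a = 0")
    \<comment> \<open>Here \<open>\<beta>\<close> vanishes too, and the whole trace 2 falls to
      \<open>y\<close>.\<close>
    case True
    with b have "\<beta> = 0" by simp
    with True \<alpha> show ?thesis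
      by (intro exI[of _ 0] exI[of _ "complex_of_real (sqrt 2)"]) (simp flip: of_real_mult)
  next
    case False
    \<comment> \<open>With \<open>x\<close> real and positive, the condition on
      \<open>\<beta>\<close> forces \<open>y\<close> to be \<open>\<beta> / x\<close>.\<close>
    define x where "x = complex_of_real (sqrt a)"
    have xx: "x * x = complex_of_real a"
      using a by (simp add: x_def flip: of_real_mult)
    have x: "x \<noteq> 0" "cnj x = x"
      using False a by (simp_all add: x_def)
    have "cnj (\<beta> / x) * (\<beta> / x) = \<beta> * cnj \<beta> / (x * x)"
      using x by (simp add: mult.commute)
    also have "\<dots> = complex_of_real (a * (2 - a) / a)"
      unfolding xx complex_norm_square[symmetric] b by simp
    also have "\<dots> = 2 - \<alpha>"
      using False \<alpha> by simp
    finally show ?thesis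
      using x xx \<alpha> by (intro exI[of _ x] exI[of _ "\<beta> / x"]) auto
  qed
qed

section \<open>From circulant Gram blocks to a 2-circulant frame\<close>

text \<open>The maps \<open>p\<close> and \<open>r\<close> list the two halves of the index set, and
  \<open>u\<close> and \<open>v\<close> are the switching scalars on them. Conditions are imposed
  entrywise, so a user need not build the permuted and switched matrix. The block from
  \<open>r\<close> to \<open>p\<close> is determined because the Gram matrix is Hermitian.\<close>

lemma equivalent_to_2circulant_etfI:
  assumes d: "d > 0" and etf: "is_etf d (2 * d) \<Phi>" and sig: "has_signature d (2 * d) \<Phi> S"
    and p: "inj_on p {..<d}" "p ` {..<d} \<subseteq> {..<2 * d}"
    and r: "inj_on r {..<d}" "r ` {..<d} \<subseteq> {..<2 * d}"
    and disj: "p ` {..<d} \<inter> r ` {..<d} = {}"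
    and u: "\<And>i. cmod (u i) = 1" and v: "\<And>i. cmod (v i) = 1"
    and A: "circulant_fun d A" and B: "circulant_fun d B"
    and pp: "\<And>i j. i < d \<Longrightarrow> j < d \<Longrightarrow> cnj (u i) * u j * S $$ (p i, p j) = A i j"
    and pr: "\<And>i j. i < d \<Longrightarrow> j < d \<Longrightarrow> cnj (u i) * v j * S $$ (p i, r j) = B i j"
    and rr: "\<And>i j. i < d \<Longrightarrow> j < d \<Longrightarrow> cnj (v i) * v j * S $$ (r i, r j) = - A i j"
  shows "equivalent_to_2circulant_etf d \<Phi>"
proof -
  from etf have \<Phi>: "\<Phi> \<in> carrier_mat d (2 * d)"
    by (simp add: is_etf_def)
  define G where "G i j = (\<Sum>l<d. cnj (\<Phi> $$ (l, i)) * \<Phi> $$ (l, j))" for i j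
  obtain \<gamma> where \<gamma>: "\<gamma> > 0"
      "\<And>i j. i < 2 * d \<Longrightarrow> j < 2 * d \<Longrightarrow> i \<noteq> j \<Longrightarrow> cmod (G i j) = \<gamma>"
    and GS: "\<And>i j. i < 2 * d \<Longrightarrow> j < 2 * d \<Longrightarrow>
      G i j = (if i = j then 1 else 0) + complex_of_real \<gamma> * S $$ (i, j)"
  proof -
    from sig obtain \<gamma> where \<gamma>: "\<gamma> > 0" and S: "S \<in> carrier_mat (2 * d) (2 * d)"
      and off: "\<forall>i<2 * d. \<forall>j<2 * d. i \<noteq> j \<longrightarrow> cmod ((mat_adjoint \<Phi> * \<Phi>) $$ (i, j)) = \<gamma>"
      and eq: "mat_adjoint \<Phi> * \<Phi> = 1\<^sub>m (2 * d) + complex_of_real \<gamma> \<cdot>\<^sub>m S"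
      unfolding has_signature_def by blast
    have gram: "(mat_adjoint \<Phi> * \<Phi>) $$ (i, j) = G i j" if "i < 2 * d" "j < 2 * d" for i j
      unfolding G_def using mat_adjoint_mult_index[OF \<Phi> \<Phi> that] .
    show ?thesis
    proof (rule that[OF \<gamma>])
      fix i j assume ij: "i < 2 * d" "j < 2 * d"
      show "cmod (G i j) = \<gamma>" if "i \<noteq> j"
        using off ij that unfolding gram[OF ij, symmetric] by blast
      show "G i j = (if i = j then 1 else 0) + complex_of_real \<gamma> * S $$ (i, j)"
        using S ij unfolding gram[OF ij, symmetric] eq by simp
    qed
  qed
  have G_cnj: "cnj (G i j) = G j i" for i j
    by (simp add: G_def mult.commute)
  \<comment> \<open>The frame identity with constant 2 makes the Gram matrix twice a
    projection.\<close>
  have G_sq: "(\<Sum>l<2 * d. G i l * G l j) = 2 * G i j" if "i < 2 * d" "j < 2 * d" for i j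
  proof -
    have frame: "(\<Sum>l<2 * d. \<Phi> $$ (a, l) * cnj (\<Phi> $$ (b, l))) = (if a = b then 2 else 0)"
      if "a < d" "b < d" for a b
      unfolding mult_mat_adjoint_index[OF \<Phi> \<Phi> that, symmetric] etf_frame_constant[OF etf d]
      using that by simp
    have "(\<Sum>l<2 * d. G i l * G l j) = (\<Sum>l<2 * d. \<Sum>a<d. \<Sum>b<d.
        cnj (\<Phi> $$ (a, i)) * \<Phi> $$ (b, j) * (\<Phi> $$ (a, l) * cnj (\<Phi> $$ (b, l))))"
      by (simp add: G_def sum_product mult_ac)
    also have "\<dots> = (\<Sum>a<d. \<Sum>b<d. cnj (\<Phi> $$ (a, i)) * \<Phi> $$ (b, j) *
        (\<Sum>l<2 * d. \<Phi> $$ (a, l) * cnj (\<Phi> $$ (b, l))))"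
      by (subst sum.swap, rule sum.cong[OF refl], subst sum.swap) (simp add: sum_distrib_left)
    also have "\<dots> = (\<Sum>a<d. \<Sum>b<d. if b = a then cnj (\<Phi> $$ (a, i)) * \<Phi> $$ (a, j) * 2 else 0)"
      by (intro sum.cong refl) (simp add: frame)
    also have "\<dots> = 2 * G i j"
      by (simp add: G_def sum_distrib_left mult_ac)
    finally show ?thesis .
  qed
  have p_less: "p i < 2 * d" and r_less: "r i < 2 * d" if "i < d" for i
    using p(2) r(2) that by auto
  have p_eq: "p i = p j \<longleftrightarrow> i = j" and r_eq: "r i = r j \<longleftrightarrow> i = j" and pr_neq: "p i \<noteq> r j"
    if "i < d" "j < d" for i j
    using p(1) r(1) disj that by (auto simp: inj_on_def)
  have uu: "cnj (u i) * u i = 1" and vv: "cnj (v i) * v i = 1"  for i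
    using complex_norm_square[of "u i"] complex_norm_square[of "v i"] u[of i] v[of i]
    by (simp_all add: mult.commute)
  \<comment> \<open>The identity has to be circulant on all pairs of naturals, so residues are
    compared.\<close>
  define I where "I i j = (if i mod d = j mod d then 1 else 0 :: complex)" for i j
  have I: "circulant_fun d I"
    by (auto simp: circulant_fun_def I_def mod_Suc)
  have I_eq: "I i j = (if i = j then 1 else 0)" if "i < d" "j < d" for i j
    using that by (simp add: I_def)
  have IA: "circulant_fun d (\<lambda>i j. I i j + complex_of_real \<gamma> * A i j)"
    and \<gamma>B: "circulant_fun d (\<lambda>i j. complex_of_real \<gamma> * B i j)"
    using I A B by (simp_all add: circulant_fun_def)
  obtain \<alpha> where
    \<alpha>: "\<And>i j. i < d \<Longrightarrow> j < d \<Longrightarrow> I i j + complex_of_real \<gamma> * A i j = circ d \<alpha> i j"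
    using circulant_fun_imp_circ[OF IA] by blast
  obtain \<beta> where
    \<beta>: "\<And>i j. i < d \<Longrightarrow> j < d \<Longrightarrow> complex_of_real \<gamma> * B i j = circ d \<beta> i j"
    using circulant_fun_imp_circ[OF \<gamma>B] by blast
  \<comment> \<open>Opposite diagonal blocks of \<open>S\<close> give the Gram blocks
    \<open>I + \<gamma> A\<close> and \<open>I - \<gamma> A = 2 I - (I + \<gamma> A)\<close>. Hence
    their eigenvalues in each mode add up to 2.\<close>
  have Gpp: "cnj (u i) * u j * G (p i) (p j) = circ d \<alpha> i j"
    and Gpr: "cnj (u i) * v j * G (p i) (r j) = circ d \<beta> i j"
    and Grr: "cnj (v i) * v j * G (r i) (r j) = 2 * I i j - circ d \<alpha> i j"
    if "i < d" "j < d" for i j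
  proof -
    have "G (p i) (p j) = I i j + complex_of_real \<gamma> * S $$ (p i, p j)"
      using that p_less p_eq[OF that] by (simp add: GS I_eq)
    moreover have "cnj (u i) * u j * I i j = I i j"
      using that uu by (simp add: I_eq)
    ultimately have "cnj (u i) * u j * G (p i) (p j)
        = I i j + complex_of_real \<gamma> * (cnj (u i) * u j * S $$ (p i, p j))"
      by (simp add: distrib_left)
    then show "cnj (u i) * u j * G (p i) (p j) = circ d \<alpha> i j"
      by (simp only: pp[OF that] \<alpha>[OF that])
    have "G (p i) (r j) = complex_of_real \<gamma> * S $$ (p i, r j)"
      using that p_less r_less pr_neq[OF that] by (simp add: GS)
    then have "cnj (u i) * v j * G (p i) (r j) = complex_of_real \<gamma> * (cnj (u i) * v j * S $$ (p i, r j))"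
      by simp
    then show "cnj (u i) * v j * G (p i) (r j) = circ d \<beta> i j"
      by (simp only: pr[OF that] \<beta>[OF that])
    have "G (r i) (r j) = I i j + complex_of_real \<gamma> * S $$ (r i, r j)"
      using that r_less r_eq[OF that] by (simp add: GS I_eq)
    moreover have "cnj (v i) * v j * I i j = I i j"
      using that vv by (simp add: I_eq)
    ultimately have "cnj (v i) * v j * G (r i) (r j)
        = I i j + complex_of_real \<gamma> * (cnj (v i) * v j * S $$ (r i, r j))"
      by (simp add: distrib_left)
    then show "cnj (v i) * v j * G (r i) (r j) = 2 * I i j - circ d \<alpha> i j"
      by (simp only: rr[OF that] \<alpha>[OF that, symmetric]) simp
  qed
  \<comment> \<open>Two disjoint injective images of size \<open>d\<close> exhaust the
    \<open>2 * d\<close> indices.\<close>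
  have split: "(\<Sum>l<2 * d. f l) = (\<Sum>l<d. f (p l)) + (\<Sum>l<d. f (r l))" for f :: "nat \<Rightarrow> complex"
  proof -
    have "card (p ` {..<d} \<union> r ` {..<d}) = 2 * d"
      using p(1) r(1) disj by (simp add: card_Un_disjoint card_image)
    then have "p ` {..<d} \<union> r ` {..<d} = {..<2 * d}"
      using p(2) r(2) by (intro card_subset_eq) auto
    then have "(\<Sum>l<2 * d. f l) = sum f (p ` {..<d}) + sum f (r ` {..<d})"
      using disj sum.union_disjoint[of "p ` {..<d}" "r ` {..<d}" f] by simp
    then show ?thesis
      using p(1) r(1) by (simp add: sum.reindex)
  qed
  \<comment> \<open>In the upper left block, \<open>G\<close> squared equal to \<open>2 G\<close> is
    an identity between circulants, as the inner switching scalars cancel. Comparing eigenvalues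
    yields the hypothesis of \<open>rank_one_factor\<close> for every mode.\<close>
  have "\<alpha> k * cnj (\<alpha> k) + \<beta> k * cnj (\<beta> k) = 2 * \<alpha> k" if "k < d" for k
  proof (rule circ_inject[OF _ that])
    fix j assume j: "j < d"
    have "circ d (\<lambda>k. \<alpha> k * cnj (\<alpha> k) + \<beta> k * cnj (\<beta> k)) 0 j =
      circ d (\<lambda>k. \<alpha> k * cnj (\<alpha> k)) 0 j + circ d (\<lambda>k. \<beta> k * cnj (\<beta> k)) 0 j"
      by (simp add: circ_def distrib_right sum.distrib add_divide_distrib)
    also have "\<dots> = (\<Sum>l<d. circ d \<alpha> 0 l * cnj (circ d \<alpha> j l)) + (\<Sum>l<d. circ d \<beta> 0 l * cnj (circ d \<beta> j l))"
      by (simp add: cnj_circ circ_mult)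
    also have "\<dots> = (\<Sum>l<d. cnj (u 0) * u j * (G (p 0) (p l) * G (p l) (p j)))
        + (\<Sum>l<d. cnj (u 0) * u j * (G (p 0) (r l) * G (r l) (p j)))"
    proof (intro arg_cong2[of _ _ _ _ "(+)"] sum.cong refl)
      fix l assume "l \<in> {..<d}"
      then have l: "l < d" by simp
      have "circ d \<alpha> 0 l * cnj (circ d \<alpha> j l) =
        cnj (u 0) * u j * (G (p 0) (p l) * G (p l) (p j)) * (cnj (u l) * u l)"
        unfolding Gpp[OF d l, symmetric] Gpp[OF j l, symmetric] by (simp add: G_cnj mult_ac)
      then show "circ d \<alpha> 0 l * cnj (circ d \<alpha> j l) = cnj (u 0) * u j * (G (p 0) (p l) * G (p l) (p j))"
        by (simp only: uu mult_1_right)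
      have "circ d \<beta> 0 l * cnj (circ d \<beta> j l) =
        cnj (u 0) * u j * (G (p 0) (r l) * G (r l) (p j)) * (cnj (v l) * v l)"
        unfolding Gpr[OF d l, symmetric] Gpr[OF j l, symmetric] by (simp add: G_cnj mult_ac)
      then show "circ d \<beta> 0 l * cnj (circ d \<beta> j l) = cnj (u 0) * u j * (G (p 0) (r l) * G (r l) (p j))"
        by (simp only: vv mult_1_right)
    qed
    also have "\<dots> = cnj (u 0) * u j * (\<Sum>l<2 * d. G (p 0) l * G l (p j))"
      by (simp add: split sum_distrib_left distrib_left)
    also have "\<dots> = 2 * circ d \<alpha> 0 j"
      unfolding G_sq[OF p_less[OF d] p_less[OF j]] Gpp[OF d j, symmetric] by simp
    also have "\<dots> = circ d (\<lambda>k. 2 * \<alpha> k) 0 j"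
      by (simp add: circ_def sum_distrib_left mult_ac)
    finally show "circ d (\<lambda>k. \<alpha> k * cnj (\<alpha> k) + \<beta> k * cnj (\<beta> k)) 0 j = circ d (\<lambda>k. 2 * \<alpha> k) 0 j" .
  qed
  then have "\<forall>k. \<exists>x y. k < d \<longrightarrow> cnj x * x = \<alpha> k \<and> cnj x * y = \<beta> k \<and> cnj y * y = 2 - \<alpha> k"
    using rank_one_factor by blast
  then obtain x y where xx: "\<And>k. k < d \<Longrightarrow> cnj (x k) * x k = \<alpha> k"
    and xy: "\<And>k. k < d \<Longrightarrow> cnj (x k) * y k = \<beta> k"
    and yy: "\<And>k. k < d \<Longrightarrow> cnj (y k) * y k = 2 - \<alpha> k"
    by metis
  have circ_cong: "circ d f i j = circ d g i j" if "\<And>k. k < d \<Longrightarrow> f k = g k" for f g i j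
    using that by (simp add: circ_def)
  have gram_circ: "(\<Sum>l<d. cnj (circ d f l i) * circ d g l j) = circ d (\<lambda>k. cnj (f k) * g k) i j" for f g i j
    by (simp add: cnj_circ circ_mult)
  \<comment> \<open>The rank one factors become the eigenvalues of the two halves; by
    \<open>gram_circ\<close> the Gram blocks of \<open>\<Psi>\<close> then have the prescribed
    eigenvalues.\<close>
  define \<Psi> where "\<Psi> = mat d (2 * d) (\<lambda>(i, j). if j < d then circ d x i j else circ d y i (j - d))"
  have \<Psi>: "\<Psi> \<in> carrier_mat d (2 * d)"
    by (simp add: \<Psi>_def)
  define \<pi> where "\<pi> j = (if j < d then p j else r (j - d))" for j
  define c where "c j = (if j < d then u j else v (j - d))" for j
  have c: "cmod (c j) = 1" for j
    by (simp add: c_def u v)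
  have \<pi>_less: "\<pi> j < 2 * d" if "j < 2 * d" for j
    using that by (auto simp: \<pi>_def intro: p_less r_less)
  have inj: "inj_on \<pi> {..<2 * d}"
    by (rule inj_onI) (auto simp: \<pi>_def p_eq r_eq pr_neq pr_neq[symmetric] split: if_splits)
  then have bij: "bij_betw \<pi> {..<2 * d} {..<2 * d}"
    using \<pi>_less by (intro bij_betw_imageI endo_inj_surj) auto
  have gram\<Psi>: "(\<Sum>l<d. cnj (\<Psi> $$ (l, i)) * \<Psi> $$ (l, j)) = cnj (c i) * c j * G (\<pi> i) (\<pi> j)"
    if "i < 2 * d" "j < 2 * d" for i j
  proof -
    consider "i < d" "j < d" | "i < d" "\<not> j < d" | "\<not> i < d" "j < d" | "\<not> i < d" "\<not> j < d"
      by blast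
    then show ?thesis
    proof cases
      case 1
      then show ?thesis
        using that by (simp add: \<Psi>_def c_def \<pi>_def gram_circ Gpp)
           (rule circ_cong, simp add: xx)
    next
      case 2
      then show ?thesis
        using that by (simp add: \<Psi>_def c_def \<pi>_def gram_circ Gpr)
           (rule circ_cong, simp add: xy)
    next
      \<comment> \<open>This block is the conjugate transpose of the one in case 2.\<close>
      case 3
      then have "cnj (c i) * c j * G (\<pi> i) (\<pi> j) = cnj (circ d \<beta> j (i - d))"
        using that by (simp add: c_def \<pi>_def Gpr[symmetric] G_cnj mult_ac)
      moreover have "(\<Sum>l<d. cnj (\<Psi> $$ (l, i)) * \<Psi> $$ (l, j))
          = cnj (\<Sum>l<d. cnj (circ d x l j) * circ d y l (i - d))"
        using 3 that by (simp add: \<Psi>_def mult_ac)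
      moreover have "(\<Sum>l<d. cnj (circ d x l j) * circ d y l (i - d)) = circ d \<beta> j (i - d)"
        unfolding gram_circ by (rule circ_cong) (rule xy)
      ultimately show ?thesis
        by simp
    next
      case 4
      then have ij: "i - d < d" "j - d < d"
        using that by auto
      have "circ d (\<lambda>k. cnj (y k) * y k) (i - d) (j - d) = circ d (\<lambda>k. 2 - \<alpha> k) (i - d) (j - d)"
        by (rule circ_cong) (rule yy)
      also have "\<dots> = circ d (\<lambda>_. 2) (i - d) (j - d) - circ d \<alpha> (i - d) (j - d)"
        by (simp add: circ_def left_diff_distrib sum_subtractf diff_divide_distrib)
      finally show ?thesis
        using 4 that ij by (simp add: \<Psi>_def c_def \<pi>_def gram_circ Grr circ_const I_eq)
    qed
  qed
  have frame\<Psi>: "\<Psi> * mat_adjoint \<Psi> = complex_of_real 2 \<cdot>\<^sub>m 1\<^sub>m d"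
  proof (rule eq_matI)
    fix i j assume "i < dim_row (complex_of_real 2 \<cdot>\<^sub>m 1\<^sub>m d)" "j < dim_col (complex_of_real 2 \<cdot>\<^sub>m 1\<^sub>m d)"
    then have ij: "i < d" "j < d" by auto
    have "(\<Sum>l<2 * d. f l) = (\<Sum>l<d. f l) + (\<Sum>l<d. f (l + d))" for f :: "nat \<Rightarrow> complex"
      using sum.atLeastLessThan_concat[of 0 d "2 * d" f] sum.shift_bounds_nat_ivl[of f 0 d d]
      by (simp add: lessThan_atLeast0 mult_2)
    then have "(\<Psi> * mat_adjoint \<Psi>) $$ (i, j) =
      (\<Sum>l<d. \<Psi> $$ (i, l) * cnj (\<Psi> $$ (j, l))) + (\<Sum>l<d. \<Psi> $$ (i, l + d) * cnj (\<Psi> $$ (j, l + d)))"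
      unfolding mult_mat_adjoint_index[OF \<Psi> \<Psi> ij] by blast
    also have "\<dots> = (\<Sum>l<d. circ d x i l * cnj (circ d x j l)) + (\<Sum>l<d. circ d y i l * cnj (circ d y j l))"
      using ij by (simp add: \<Psi>_def)
    also have "\<dots> = circ d (\<lambda>k. x k * cnj (x k)) i j + circ d (\<lambda>k. y k * cnj (y k)) i j"
      by (simp add: cnj_circ circ_mult)
    also have "\<dots> = circ d (\<lambda>k. x k * cnj (x k) + y k * cnj (y k)) i j"
      by (simp add: circ_def distrib_right sum.distrib add_divide_distrib)
    also have "\<dots> = circ d (\<lambda>_. 2) i j"
      by (rule circ_cong) (simp add: xx yy mult.commute[of _ "cnj _"])
    finally show "(\<Psi> * mat_adjoint \<Psi>) $$ (i, j) = (complex_of_real 2 \<cdot>\<^sub>m 1\<^sub>m d) $$ (i, j)"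
      using ij by (simp add: circ_const)
  qed (use \<Psi> in auto)
  \<comment> \<open>The reindexed and switched copy of \<open>\<Phi>\<close> has the same Gram
    matrix as \<open>\<Psi>\<close>, so only a unitary separates the two.\<close>
  define \<Phi>' where "\<Phi>' = mat d (2 * d) (\<lambda>(l, j). c j * \<Phi> $$ (l, \<pi> j))"
  have \<Phi>': "\<Phi>' \<in> carrier_mat d (2 * d)"
    by (simp add: \<Phi>'_def)
  have gram: "mat_adjoint \<Phi>' * \<Phi>' = mat_adjoint \<Psi> * \<Psi>"
  proof (rule eq_matI)
    fix i j assume "i < dim_row (mat_adjoint \<Psi> * \<Psi>)" "j < dim_col (mat_adjoint \<Psi> * \<Psi>)"
    then have ij: "i < 2 * d" "j < 2 * d"
      using \<Psi> by auto
    then have "(mat_adjoint \<Phi>' * \<Phi>') $$ (i, j) = cnj (c i) * c j * G (\<pi> i) (\<pi> j)"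
      unfolding mat_adjoint_mult_index[OF \<Phi>' \<Phi>' ij]
      by (simp add: \<Phi>'_def G_def sum_distrib_left mult_ac)
    then show "(mat_adjoint \<Phi>' * \<Phi>') $$ (i, j) = (mat_adjoint \<Psi> * \<Psi>) $$ (i, j)"
      by (simp add: mat_adjoint_mult_index[OF \<Psi> \<Psi> ij] gram\<Psi>[OF ij])
  qed (use \<Psi> \<Phi>' in auto)
  obtain U where U: "is_unitary d U" "\<Psi> = U * \<Phi>'"
    using unitary_of_equal_gram[OF \<Phi>' \<Psi> gram frame\<Psi>] by auto
  have "is_etf d (2 * d) \<Psi>"
    unfolding is_etf_def
  proof (intro conjI allI impI exI)
    show "\<Psi> \<in> carrier_mat d (2 * d)"
      by (rule \<Psi>)
    show "\<Psi> * mat_adjoint \<Psi> = complex_of_real 2 \<cdot>\<^sub>m 1\<^sub>m d"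
      by (rule frame\<Psi>)
    show "cmod ((mat_adjoint \<Psi> * \<Psi>) $$ (i, j)) = \<gamma>" if ij: "i < 2 * d" "j < 2 * d" "i \<noteq> j" for i j
    proof -
      have "\<pi> i \<noteq> \<pi> j"
        using inj ij by (auto simp: inj_on_def)
      then show ?thesis
        using ij \<gamma>(2) \<pi>_less
        by (simp add: mat_adjoint_mult_index[OF \<Psi> \<Psi>] gram\<Psi> norm_mult c)
    qed
    fix j assume j: "j < 2 * d"
    have "col \<Psi> j \<bullet>c col \<Psi> j = (\<Sum>l<d. cnj (\<Psi> $$ (l, j)) * \<Psi> $$ (l, j))"
      using \<Psi> j by (simp add: scalar_prod_def lessThan_atLeast0 mult.commute)
    also have "\<dots> = cnj (c j) * c j * G (\<pi> j) (\<pi> j)"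
      by (rule gram\<Psi>[OF j j])
    also have "G (\<pi> j) (\<pi> j) = col \<Phi> (\<pi> j) \<bullet>c col \<Phi> (\<pi> j)"
      using \<Phi> \<pi>_less[OF j] by (simp add: G_def scalar_prod_def lessThan_atLeast0 mult.commute)
    also have "\<dots> = 1"
      using etf \<pi>_less[OF j] by (simp add: is_etf_def)
    also have "cnj (c j) * c j = 1"
      by (simp add: c_def uu vv)
    finally show "col \<Psi> j \<bullet>c col \<Psi> j = 1"
      by simp
  qed
  moreover have "is_2circulant d \<Psi>"
    unfolding is_2circulant_def
  proof (intro exI conjI)
    show "is_circulant d (mat d d (\<lambda>(i, j). circ d x i j))" "is_circulant d (mat d d (\<lambda>(i, j). circ d y i j))"
      by (rule is_circulant_mat, rule circulant_fun_circ)+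
    show "\<Psi> = mat d (2 * d) (\<lambda>(i, j). if j < d then mat d d (\<lambda>(i, j). circ d x i j) $$ (i, j)
        else mat d d (\<lambda>(i, j). circ d y i j) $$ (i, j - d))"
      by (rule eq_matI) (auto simp: \<Psi>_def)
  qed
  moreover have "switching_equivalent d (2 * d) \<Phi> \<Psi>"
    unfolding switching_equivalent_def
  proof (intro conjI exI allI impI)
    fix j assume j: "j < 2 * d"
    have cU: "U \<in> carrier_mat d d"
      using U(1) by (simp add: is_unitary_def)
    have "col \<Psi> j = U *\<^sub>v col \<Phi>' j"
      unfolding U(2) by (rule col_mult2[OF cU \<Phi>' j])
    also have "col \<Phi>' j = c j \<cdot>\<^sub>v col \<Phi> (\<pi> j)"
      using \<Phi> j \<pi>_less[OF j] by (intro eq_vecI) (auto simp: \<Phi>'_def)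
    also have "U *\<^sub>v (c j \<cdot>\<^sub>v col \<Phi> (\<pi> j)) = c j \<cdot>\<^sub>v (U *\<^sub>v col \<Phi> (\<pi> j))"
      by (rule mult_mat_vec[OF cU]) (use \<Phi> \<pi>_less[OF j] in auto)
    finally show "col \<Psi> j = c j \<cdot>\<^sub>v (U *\<^sub>v col \<Phi> (\<pi> j))" .
  qed (use \<Phi> \<Psi> U c bij in auto)
  ultimately show ?thesis
    by (auto simp: equivalent_to_2circulant_etf_def)
qed

section \<open>The projective line as a cyclic group\<close>

text \<open>In odd order, 1 and -1 are distinct with equal squares. Squaring is thus not injective,
  hence not surjective on a finite set.\<close>

lemma exists_nonsquare:
  assumes "odd CARD('a :: {field, finite})"
  shows "\<exists>n :: 'a. \<forall>b. n \<noteq> b ^ 2"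
proof -
  have "(1 :: 'a) \<noteq> - 1"
  proof
    assume "(1 :: 'a) = - 1"
    then have "of_nat 2 = (0 :: 'a)"
      by (metis add.right_inverse of_nat_numeral one_add_one)
    then have "CHAR('a) dvd 2"
      by (simp only: of_nat_eq_0_iff_char_dvd)
    then have "CHAR('a) = 1 \<or> CHAR('a) = 2"
      using prime_nat_iff two_is_prime_nat by blast
    moreover have "CHAR('a) dvd CARD('a)"
      by (rule CHAR_dvd_CARD)
    ultimately show False
      using assms by auto
  qed
  then have "\<not> inj (\<lambda>b :: 'a. b ^ 2)"
    by (metis injD one_power2 power2_minus)
  then have "\<not> surj (\<lambda>b :: 'a. b ^ 2)"
    using finite_UNIV_surj_inj[OF finite_class.finite_UNIV] by blast
  then show ?thesis
    unfolding surj_def by auto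
qed

section \<open>The quadratic extension and its cyclic multiplicative group\<close>

text \<open>The pair \<open>(a, b)\<close> stands for a + b sqrt(n).\<close>

definition quad_mult :: "'a :: field \<Rightarrow> 'a \<times> 'a \<Rightarrow> 'a \<times> 'a \<Rightarrow> 'a \<times> 'a" where
  "quad_mult n v w = (fst v * fst w + n * snd v * snd w, fst v * snd w + snd v * fst w)"

text \<open>The extension is an explicit ring record, so that the theorem on cyclic multiplicative
  groups of finite fields applies to it.\<close>

definition quad_ext :: "'a :: field \<Rightarrow> ('a \<times> 'a) ring" where
  "quad_ext n = \<lparr> carrier = UNIV,
     monoid.mult = quad_mult n, one = (1, 0),
     zero = (0, 0), add = (\<lambda>(a, b) (c, d). (a + c, b + d)) \<rparr>"

definition quad_norm :: "'a :: field \<Rightarrow> 'a \<times> 'a \<Rightarrow> 'a" where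
  "quad_norm n v = fst v ^ 2 - n * snd v ^ 2"

text \<open>A zero of the norm with nonzero second coordinate would exhibit \<open>n\<close> as the
  square of a quotient.\<close>

lemma quad_norm_eq_0_iff:
  assumes "\<And>b :: 'a :: field. n \<noteq> b ^ 2"
  shows "quad_norm n v = 0 \<longleftrightarrow> v = (0, 0)"
proof
  assume *: "quad_norm n v = 0"
  have "snd v = 0"
  proof (rule ccontr)
    assume "snd v \<noteq> 0"
    then have "n = (fst v / snd v) ^ 2"
      using * by (simp add: quad_norm_def field_simps)
    then show False
      using assms by blast
  qed
  then show "v = (0, 0)"
    using * by (simp add: quad_norm_def prod_eq_iff)
qed (simp add: quad_norm_def)

lemma field_quad_ext:
  assumes "\<And>b :: 'a :: field. n \<noteq> b ^ 2"
  shows "Ring.field (quad_ext n)"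
proof (rule cring.cring_fieldI2)
  have "\<exists>y. y \<oplus>\<^bsub>quad_ext n\<^esub> x = \<zero>\<^bsub>quad_ext n\<^esub>" for x
    by (rule exI[of _ "(- fst x, - snd x)"]) (simp add: quad_ext_def split: prod.splits)
  then show "cring (quad_ext n)"
    by unfold_locales (auto simp: quad_ext_def quad_mult_def Units_def algebra_simps split: prod.splits)
  show "\<zero>\<^bsub>quad_ext n\<^esub> \<noteq> \<one>\<^bsub>quad_ext n\<^esub>"
    by (simp add: quad_ext_def)
  fix v assume "v \<noteq> \<zero>\<^bsub>quad_ext n\<^esub>"
  then have nz: "quad_norm n v \<noteq> 0"
    using assms by (simp add: quad_norm_eq_0_iff quad_ext_def)
  obtain a b where v: "v = (a, b)" by force
  \<comment> \<open>The inverse is the conjugate divided by the norm.\<close>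
  have "v \<otimes>\<^bsub>quad_ext n\<^esub> (a / quad_norm n v, - b / quad_norm n v) = \<one>\<^bsub>quad_ext n\<^esub>"
    using nz unfolding v by (simp add: quad_ext_def quad_mult_def quad_norm_def divide_simps) (simp add: power2_eq_square algebra_simps)
  then show "\<exists>w \<in> carrier (quad_ext n). v \<otimes>\<^bsub>quad_ext n\<^esub> w = \<one>\<^bsub>quad_ext n\<^esub>"
    by (auto simp: quad_ext_def)
qed

text \<open>Powers of the generator are restated as iterates of multiplication by \<open>g\<close>;
  from here on only pairs over the base field appear.\<close>

lemma quad_ext_cyclic:
  assumes "\<And>b :: 'a :: {field, finite}. n \<noteq> b ^ 2"
  obtains g where "g \<noteq> (0, 0)" "\<And>v. v \<noteq> (0, 0) \<Longrightarrow> \<exists>i. v = (quad_mult n g ^^ i) (1, 0)"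
proof -
  interpret R: Ring.field "quad_ext n"
    by (rule field_quad_ext) (rule assms)
  have "finite (carrier (quad_ext n))"
    by (rule finite)
  from R.finite_field_mult_group_has_gen[OF this]
  obtain g where g: "g \<in> carrier (mult_of (quad_ext n))"
    and gen: "carrier (mult_of (quad_ext n)) = {g [^]\<^bsub>quad_ext n\<^esub> i | i::nat. i \<in> UNIV}"
    by (elim bexE)
  have pow: "g [^]\<^bsub>quad_ext n\<^esub> i = (quad_mult n g ^^ i) (1, 0)" for i :: nat
  proof (induction i)
    case (Suc i)
    have "g [^]\<^bsub>quad_ext n\<^esub> Suc i = g \<otimes>\<^bsub>quad_ext n\<^esub> g [^]\<^bsub>quad_ext n\<^esub> i"
      by (rule R.nat_pow_Suc2) (simp add: quad_ext_def)
    with Suc show ?case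
      by (simp add: quad_ext_def)
  qed (simp add: quad_ext_def nat_pow_def)
  have nz: "carrier (mult_of (quad_ext n)) = - {(0, 0)}"
    by (auto simp: quad_ext_def)
  show ?thesis
  proof
    show "g \<noteq> (0, 0)"
      using g unfolding nz by auto
    show "\<exists>i. v = (quad_mult n g ^^ i) (1, 0)" if "v \<noteq> (0, 0)" for v
      using that gen pow unfolding nz by auto
  qed
qed

section \<open>Determinants and the projective line\<close>

definition pair_det :: "'a :: field \<times> 'a \<Rightarrow> 'a \<times> 'a \<Rightarrow> 'a" where
  "pair_det v w = fst v * snd w - snd v * fst w"

definition proj_point :: "'a :: field \<times> 'a \<Rightarrow> 'a option" where
  "proj_point v = (if snd v = 0 then None else Some (fst v / snd v))"

text \<open>This is the character of the scalar by which \<open>v\<close> differs from the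
  normalized representative \<open>(1, 0)\<close> or \<open>(a, 1)\<close> of its point.\<close>

definition proj_sign :: "'a :: field \<times> 'a \<Rightarrow> complex" where
  "proj_sign v = (if snd v = 0 then quad_char (fst v) else quad_char (snd v))"

text \<open>Multiplication by \<open>g\<close> is a linear map whose determinant is the norm of
  \<open>g\<close>.\<close>

lemma pair_det_quad_mult:
  "pair_det (quad_mult n g v) (quad_mult n g w) = quad_norm n g * pair_det v w"
  by (simp add: pair_det_def quad_mult_def quad_norm_def power2_eq_square algebra_simps)

lemma quad_norm_mult: "quad_norm n (quad_mult n v w) = quad_norm n v * quad_norm n w"
  by (simp add: quad_mult_def quad_norm_def power2_eq_square algebra_simps)

lemma proj_point_eq_iff:
  assumes "v \<noteq> (0, 0)" "w \<noteq> (0, 0)"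
  shows "proj_point v = proj_point w \<longleftrightarrow> pair_det v w = 0"
  using assms by (cases v; cases w) (auto simp: proj_point_def pair_det_def frac_eq_eq mult.commute)

text \<open>For the representatives \<open>(a, 1)\<close> and \<open>(1, 0)\<close> the determinants
  are \<open>a - b\<close>, 1, -1 and 0, whose characters are the Paley entries. Rescaling a vector
  multiplies the character of the determinant by that of the scalar, which is a sign and is undone
  by \<open>proj_sign\<close>.\<close>

lemma paley_entry_proj_point:
  fixes v w :: "'a :: field \<times> 'a"
  assumes mult: "\<And>a b :: 'a. quad_char (a * b) = quad_char a * quad_char b"
    and "v \<noteq> (0, 0)" "w \<noteq> (0, 0)"
  shows "paley_conference_entry (proj_point v) (proj_point w)
       = proj_sign v * proj_sign w * quad_char (pair_det v w)"
proof -
  obtain a b c d where vw: "v = (a, b)" "w = (c, d)" by force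
  have pm: "quad_char x = 1 \<or> quad_char x = - 1" if "x \<noteq> 0" for x :: 'a
    using that by (simp add: quad_char_def)
  consider "b = 0" "d = 0" | "b = 0" "d \<noteq> 0" | "b \<noteq> 0" "d = 0" | "b \<noteq> 0" "d \<noteq> 0"
    by blast
  then show ?thesis
  proof cases
    case 1
    then show ?thesis by (simp add: vw proj_point_def pair_det_def quad_char_def)
  next
    case 2
    then show ?thesis
      using assms(2) pm[of a] pm[of d]
      by (auto simp: vw proj_point_def proj_sign_def pair_det_def mult)
  next
    case 3
    have "quad_char (- (b * c)) = quad_char (- 1 :: 'a) * quad_char b * quad_char c"
      using mult[of "- 1" "b * c"] mult[of b c] by simp
    with 3 show ?thesis
      using assms(3) pm[of b] pm[of c]
      by (auto simp: vw proj_point_def proj_sign_def pair_det_def)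
  next
    case 4
    then have "a * d - b * c = b * d * (a / b - c / d)"
      by (simp add: field_simps)
    then have "quad_char (a * d - b * c) = quad_char b * quad_char d * quad_char (a / b - c / d)"
      by (simp only: mult)
    with 4 show ?thesis
      using pm[of b] pm[of d]
      by (auto simp: vw proj_point_def proj_sign_def pair_det_def)
  qed
qed

text \<open>If the generator \<open>c\<close> were a square, so would be its power \<open>n\<close>.
  Hence \<open>c ^ k\<close> has character \<open>(- 1) ^ k\<close>, and multiplicativity is
  addition of exponents.\<close>

lemma quad_char_mult_of_generator:
  fixes c n x y :: "'a :: field"
  assumes gen: "\<And>x. x \<noteq> 0 \<Longrightarrow> \<exists>k. x = c ^ k" and n: "\<And>b. n \<noteq> b ^ 2"
  shows "quad_char c = - 1" and "quad_char (x * y) = quad_char x * quad_char y"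
proof -
  have "n \<noteq> 0"
    using n[of 0] by auto
  then obtain k where k: "n = c ^ k"
    using gen by blast
  have "c \<noteq> b ^ 2" for b
    using n[of "b ^ k"] k by (auto simp: power_mult[symmetric] mult.commute)
  moreover from this[of 0] have c0: "c \<noteq> 0"
    by simp
  ultimately have c: "\<nexists>b. c = b ^ 2" and c0: "c \<noteq> 0"
    by blast+
  show "quad_char c = - 1"
    using c c0 by (simp add: quad_char_def)
  have power: "quad_char (c ^ k) = (- 1) ^ k" for k
  proof (cases "even k")
    case True
    then obtain l where "k = 2 * l" ..
    then have "c ^ k = (c ^ l) ^ 2"
      by (simp add: power_mult[symmetric] mult.commute)
    with True c0 show ?thesis
      unfolding quad_char_def by auto
  next
    case False
    then obtain l where l: "k = 2 * l + 1"
      by (rule oddE)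
    have "c ^ k \<noteq> b ^ 2" for b
    proof
      assume "c ^ k = b ^ 2"
      then have "c = (b / c ^ l) ^ 2"
        using c0 by (simp add: l power_mult[symmetric] power_divide mult.commute field_simps)
      with c show False
        by blast
    qed
    with False c0 show ?thesis
      by (simp add: quad_char_def)
  qed
  show "quad_char (x * y) = quad_char x * quad_char y"
  proof (cases "x = 0 \<or> y = 0")
    case True
    then show ?thesis by (auto simp: quad_char_def)
  next
    case False
    then obtain k l where "x = c ^ k" "y = c ^ l"
      using gen by blast
    then show ?thesis
      by (simp add: power power_add[symmetric])
  qed
qed

text \<open>If all norms were squares then so would be \<open>-n\<close>, so \<open>-1\<close> would be a nonsquare and \<open>n\<close> could be
  taken to be \<open>-1\<close>; squares would be closed under addition. But \<open>-1\<close> is a sum of ones.\<close>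

lemma exists_nonsquare_quad_norm:
  fixes n :: "'a :: {field, finite}"
  assumes n: "\<And>b. n \<noteq> b ^ 2"
  shows "\<exists>v. \<forall>b. quad_norm n v \<noteq> b ^ 2"
proof (rule ccontr)
  assume "\<not> ?thesis"
  then have norm: "\<exists>b. quad_norm n v = b ^ 2" for v
    by blast
  have n0: "n \<noteq> 0"
    using n[of 0] by auto
  have "\<exists>b. - n = b ^ 2"
    using norm[of "(0, 1)"] by (simp add: quad_norm_def)
  then obtain r where r: "- n = r ^ 2"
    by blast
  then have n_eq: "n = - (r ^ 2)"
    by (metis minus_minus)
  have r0: "r \<noteq> 0"
    using n0 r by auto
  have nonsq: "- 1 \<noteq> b ^ 2" for b :: 'a
    using r n[of "b * r"] by (metis mult_minus1 power_mult_distrib minus_minus)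
  have add: "\<exists>b. x ^ 2 + y ^ 2 = b ^ 2" for x y :: 'a
  proof -
    \<comment> \<open>Rescaling the second coordinate by \<open>r\<close> turns the norm form into a
      sum of two squares.\<close>
    have "quad_norm n (x, y / r) = x ^ 2 + y ^ 2"
      using r0 by (simp add: quad_norm_def power_divide n_eq)
    then show ?thesis
      using norm by metis
  qed
  have of_nat: "\<exists>b :: 'a. of_nat k = b ^ 2" for k
  proof (induction k)
    case 0
    show ?case by (rule exI[of _ 0]) simp
  next
    case (Suc k)
    then obtain b :: 'a where "of_nat k = b ^ 2" ..
    then show ?case
      using add[of 1 b] by simp
  qed
  have "CHAR('a) > 0"
    by (rule finite_imp_CHAR_pos) simp
  then have "of_nat (CHAR('a) - 1) = (- 1 :: 'a)"
    by (simp add: of_nat_diff Suc_leI)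
  then show False
    using of_nat nonsq by metis
qed

section \<open>The Paley conference matrix in cyclic form\<close>

text \<open>Points are powers of a generator \<open>g\<close>, \<open>t\<close> holds their
  normalizing signs and \<open>s\<close> the characters of determinants. One shift multiplies
  determinants by the norm of \<open>g\<close>, and a column shift by q + 1 multiplies them by a
  generator \<open>c\<close> of the base field. Both factors are nonsquares, whence the two minus
  signs.\<close>

lemma paley_conference_cyclic:
  assumes "odd CARD('a :: {field, finite})"
  obtains pt :: "nat \<Rightarrow> 'a :: {field, finite} option" and t :: "nat \<Rightarrow> complex" and s :: "nat \<Rightarrow> nat \<Rightarrow> complex"
  where "bij_betw pt {..<CARD('a) + 1} UNIV"
    and "\<And>i. t i = 1 \<or> t i = - 1"
    and "\<And>i j. s (Suc i) (Suc j) = - s i j"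
    and "\<And>i j. s i (j + (CARD('a) + 1)) = - s i j"
    and "\<And>i j. paley_conference_entry (pt i) (pt j) = t i * t j * s i j"
proof -
  obtain n :: 'a where n: "\<And>b. n \<noteq> b ^ 2"
    using exists_nonsquare[OF assms] by blast
  obtain g where g: "g \<noteq> (0, 0)" and gen: "\<And>v. v \<noteq> (0, 0) \<Longrightarrow> \<exists>i. v = (quad_mult n g ^^ i) (1, 0)"
    using quad_ext_cyclic[OF n] by blast
  define w where "w i = (quad_mult n g ^^ i) (1, 0)" for i
  have w0 [simp]: "w 0 = (1, 0)" and w_Suc: "w (Suc i) = quad_mult n g (w i)" for i
    by (simp_all add: w_def)
  have gen: "\<exists>i. v = w i" if "v \<noteq> (0, 0)" for v
    using gen that by (simp add: w_def)
  have norm_w: "quad_norm n (w i) = quad_norm n g ^ i" for i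
    by (induction i) (simp_all add: w_Suc quad_norm_mult, simp add: quad_norm_def)
  have norm_g: "quad_norm n g \<noteq> 0"
    using quad_norm_eq_0_iff[OF n] g by simp
  have w_nz: "w i \<noteq> (0, 0)" for i
    using quad_norm_eq_0_iff[OF n, of "w i"] norm_w norm_g by simp
  have w_add: "w (i + j) = quad_mult n (w i) (w j)" for i j
    by (induction i) (simp_all add: w_Suc quad_mult_def algebra_simps)
  have det_Suc: "pair_det (w (Suc i)) (w (Suc j)) = quad_norm n g * pair_det (w i) (w j)" for i j
    by (simp add: w_Suc pair_det_quad_mult)
  have det_add: "pair_det (w i) (w (i + k)) = quad_norm n g ^ i * snd (w k)" for i k
    by (induction i) (simp_all add: det_Suc, simp add: pair_det_def)
  \<comment> \<open>The least positive power of \<open>g\<close> lying in the base field: its order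
    modulo the scalars. It exists because infinitely many powers meet only finitely many
    points.\<close>
  define m where "m = (LEAST m. m > 0 \<and> snd (w m) = 0)"
  have "\<exists>m>0. snd (w m) = 0"
  proof -
    have "\<not> inj (\<lambda>i. proj_point (w i))"
      using finite_imageD[of _ "UNIV :: nat set"] by (metis finite infinite_UNIV_nat)
    then obtain i j where "i < j" "proj_point (w i) = proj_point (w j)"
      by (metis injI nat_neq_iff)
    then have "pair_det (w i) (w (i + (j - i))) = 0"
      using proj_point_eq_iff w_nz by (metis add_diff_inverse_nat less_imp_not_less)
    then have "snd (w (j - i)) = 0"
      using norm_g by (simp only: det_add) simp
    with \<open>i < j\<close> show ?thesis
      by (intro exI[of _ "j - i"]) simp
  qed
  from LeastI_ex[OF this] have m: "m > 0" "snd (w m) = 0"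
    by (simp_all add: m_def)
  have m_least: "snd (w k) \<noteq> 0" if "0 < k" "k < m" for k
    using that not_less_Least[of k "\<lambda>m. m > 0 \<and> snd (w m) = 0"] by (auto simp: m_def)
  define c where "c = fst (w m)"
  have wm: "w m = (c, 0)"
    using m by (simp add: c_def prod_eq_iff)
  have c0: "c \<noteq> 0"
    using w_nz[of m] wm by simp
  have w_add_m: "w (i + m) = (c * fst (w i), c * snd (w i))" for i
    by (simp add: w_add wm quad_mult_def mult.commute)
  have w_mult_m: "w (i + m * k) = (c ^ k * fst (w i), c ^ k * snd (w i))" for i k
    by (induction k) (simp_all add: w_add_m add.assoc[symmetric] add.commute[of m] mult.assoc)
  have pt_mult_m: "proj_point (w (i + m * k)) = proj_point (w i)" for i k
    using c0 by (simp add: w_mult_m proj_point_def)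
  have bij: "bij_betw (\<lambda>i. proj_point (w i)) {..<m} UNIV"
  proof (rule bij_betwI')
    have *: "proj_point (w i) \<noteq> proj_point (w j)" if "i < j" "j < m" for i j
    proof
      assume "proj_point (w i) = proj_point (w j)"
      then have "pair_det (w i) (w (i + (j - i))) = 0"
        using proj_point_eq_iff[OF w_nz w_nz, of i j] that by simp
      then have "snd (w (j - i)) = 0"
        using norm_g by (simp only: det_add) simp
      with m_least[of "j - i"] that show False
        by (simp add: less_imp_diff_less)
    qed
    show "proj_point (w i) = proj_point (w j) \<longleftrightarrow> i = j" if "i \<in> {..<m}" "j \<in> {..<m}" for i j
      using that *[of i j] *[of j i] by (cases i j rule: linorder_cases) auto
    show "\<exists>i \<in> {..<m}. p = proj_point (w i)" for p
    proof -
      have "\<exists>v. v \<noteq> (0, 0) \<and> p = proj_point v"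
      proof (cases p)
        case None
        then show ?thesis by (intro exI[of _ "(1, 0)"]) (simp add: proj_point_def)
      next
        case (Some a)
        then show ?thesis by (intro exI[of _ "(a, 1)"]) (simp add: proj_point_def)
      qed
      then obtain i where "p = proj_point (w i)"
        using gen by blast
      then have "p = proj_point (w (i mod m))"
        using pt_mult_m[of "i mod m" "i div m"] by simp
      then show ?thesis
        using m by (intro bexI[of _ "i mod m"]) auto
    qed
  qed simp
  have m_eq: "m = CARD('a) + 1"
    using bij_betw_same_card[OF bij] by (simp add: card_UNIV_option)
  \<comment> \<open>A power of \<open>g\<close> is a scalar only if its exponent is a multiple of
    \<open>m\<close>, and is then a power of \<open>c\<close>; so \<open>c\<close> generates the
    nonzero scalars.\<close>
  have "\<exists>k. x = c ^ k" if "x \<noteq> 0" for x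
  proof -
    obtain i where i: "(x, 0) = w i"
      using gen[of "(x, 0)"] \<open>x \<noteq> 0\<close> by auto
    have wi: "w i = (c ^ (i div m) * fst (w (i mod m)), c ^ (i div m) * snd (w (i mod m)))"
      using w_mult_m[of "i mod m" "i div m"] by simp
    then have "snd (w (i mod m)) = 0"
      using i c0 by (metis mult_eq_0_iff power_not_zero snd_conv)
    then have "i mod m = 0"
      using m_least[of "i mod m"] m by (cases "i mod m = 0") auto
    then show ?thesis
      using wi i by auto
  qed
  note chi = quad_char_mult_of_generator[OF this n]
  \<comment> \<open>If the norm of \<open>g\<close> were a square, the norm of every power of
    \<open>g\<close>, hence every nonzero norm, would be one.\<close>
  have chi_norm: "quad_char (quad_norm n g) = - 1"
  proof (rule ccontr)
    assume "quad_char (quad_norm n g) \<noteq> - 1"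
    then obtain b where "quad_norm n g = b ^ 2"
      unfolding quad_char_def using norm_g by (metis (full_types))
    then have sq: "quad_norm n (w i) = (b ^ i) ^ 2" for i
      by (simp add: norm_w power_mult[symmetric] mult.commute)
    obtain v where v: "\<And>b. quad_norm n v \<noteq> b ^ 2"
      using exists_nonsquare_quad_norm[OF n] by blast
    have "v \<noteq> (0, 0)"
      using v[of 0] by (auto simp: quad_norm_def)
    with gen sq v show False
      by metis
  qed
  show ?thesis
  proof (rule that[of "\<lambda>i. proj_point (w i)" "\<lambda>i. proj_sign (w i)"
        "\<lambda>i j. quad_char (pair_det (w i) (w j))"])
    show "bij_betw (\<lambda>i. proj_point (w i)) {..<CARD('a) + 1} UNIV"
      using bij by (simp only: m_eq)
    show "proj_sign (w i) = 1 \<or> proj_sign (w i) = - 1" for i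
      using w_nz[of i] by (cases "w i") (auto simp: proj_sign_def quad_char_def)
    show "quad_char (pair_det (w (Suc i)) (w (Suc j))) = - quad_char (pair_det (w i) (w j))" for i j
      by (simp add: det_Suc chi chi_norm)
    have "pair_det (w i) (w (j + m)) = c * pair_det (w i) (w j)" for i j
      by (simp add: w_add_m pair_det_def algebra_simps)
    then have "quad_char (pair_det (w i) (w (j + m))) = - quad_char (pair_det (w i) (w j))" for i j
      by (simp add: chi)
    then show "quad_char (pair_det (w i) (w (j + (CARD('a) + 1)))) = - quad_char (pair_det (w i) (w j))" for i j
      by (simp only: m_eq)
    show "paley_conference_entry (proj_point (w i)) (proj_point (w j))
      = proj_sign (w i) * proj_sign (w j) * quad_char (pair_det (w i) (w j))" for i j
      using w_nz by (intro paley_entry_proj_point chi)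
  qed
qed

section \<open>The three families\<close>

lemma bij_betw_of_nat_prime_field:
  assumes "prime CARD('a :: {field, finite})"
  shows "bij_betw (of_nat :: nat \<Rightarrow> 'a) {..<CARD('a)} UNIV"
proof -
  have "CHAR('a) dvd CARD('a)"
    by (rule CHAR_dvd_CARD)
  moreover have "CHAR('a) \<noteq> 1"
    by simp
  ultimately have "CHAR('a) = CARD('a)"
    using assms by (metis prime_nat_iff)
  then have "inj_on (of_nat :: nat \<Rightarrow> 'a) {..<CARD('a)}"
    by (auto simp: inj_on_def of_nat_eq_iff_cong_CHAR cong_def)
  then show ?thesis
    unfolding bij_betw_def
    by (simp add: card_image card_subset_eq)
qed

text \<open>In both congruence classes the blocks depend only on the difference of two field
  elements. Listing the field as 0, 1, ..., q - 1 makes them circulant, with no switching.\<close>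

lemma type_2_G_equivalent:
  fixes e :: "nat \<Rightarrow> 'a :: {field, finite}"
  assumes prime: "prime CARD('a)" and q: "q = CARD('a)" and e: "bij_betw e {..<q} UNIV"
    and etf: "is_etf q (2 * q) \<Phi>" and sig: "has_signature q (2 * q) \<Phi> (four_block_mat A B C D)"
    and carrier: "A \<in> carrier_mat q q" "D \<in> carrier_mat q q"
    and A: "\<And>i j. i < q \<Longrightarrow> j < q \<Longrightarrow> A $$ (i, j) = f (e i - e j)"
    and B: "\<And>i j. i < q \<Longrightarrow> j < q \<Longrightarrow> B $$ (i, j) = g (e i - e j)"
    and D: "\<And>i j. i < q \<Longrightarrow> j < q \<Longrightarrow> D $$ (i, j) = - f (e i - e j)"
  shows "equivalent_to_2circulant_etf q \<Phi>"
proof -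
  \<comment> \<open>The position at which \<open>e\<close> lists the field element
    \<open>of_nat i\<close>.\<close>
  define p where "p i = inv_into {..<q} e (of_nat i)" for i
  have e_p: "e (p i) = of_nat i" for i
    unfolding p_def by (rule f_inv_into_f) (use e in \<open>auto simp: bij_betw_def\<close>)
  have p_less: "p i < q" for i
    using inv_into_into[of "of_nat i" e "{..<q}"] e by (simp add: p_def bij_betw_def)
  have inj: "inj_on p {..<q}"
    using bij_betw_imp_inj_on[OF bij_betw_of_nat_prime_field[OF prime]]
    unfolding inj_on_def by (metis e_p q)
  have of_nat_q: "of_nat q = (0 :: 'a)"
    using CHAR_dvd_CARD[where 'a = 'a] by (simp add: of_nat_eq_0_iff_char_dvd q)
  show ?thesis
  proof (rule equivalent_to_2circulant_etfI[OF _ etf sig, of p "\<lambda>i. p i + q" "\<lambda>_. 1" "\<lambda>_. 1"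
        "\<lambda>i j. f (of_nat i - of_nat j)" "\<lambda>i j. g (of_nat i - of_nat j)"])
    show "q > 0"
      using prime q by (simp add: prime_gt_0_nat)
    show "inj_on p {..<q}" "inj_on (\<lambda>i. p i + q) {..<q}"
      using inj by (simp_all add: inj_on_def)
    show "p ` {..<q} \<subseteq> {..<2 * q}" "(\<lambda>i. p i + q) ` {..<q} \<subseteq> {..<2 * q}"
      using p_less by (auto simp: mult_2 trans_less_add1)
    show "p ` {..<q} \<inter> (\<lambda>i. p i + q) ` {..<q} = {}"
    proof -
      have "p i \<noteq> p j + q" for i j
        using p_less[of i] by simp
      then show ?thesis
        by auto
    qed
    show "circulant_fun q (\<lambda>i j. f (of_nat i - of_nat j))" "circulant_fun q (\<lambda>i j. g (of_nat i - of_nat j))"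
      by (simp_all add: circulant_fun_def of_nat_q)
    show "cnj 1 * 1 * four_block_mat A B C D $$ (p i, p j) = f (of_nat i - of_nat j)"
      "cnj 1 * 1 * four_block_mat A B C D $$ (p i, p j + q) = g (of_nat i - of_nat j)"
      "cnj 1 * 1 * four_block_mat A B C D $$ (p i + q, p j + q) = - f (of_nat i - of_nat j)" for i j
      using carrier p_less[of i] p_less[of j] by (simp_all add: A B D e_p)
  qed simp_all
qed

section \<open>Paley matrices in a given enumeration and type G_q + 1\<close>

lemma paley_conference_mat_carrier:
  fixes e :: "nat \<Rightarrow> 'a :: {field, finite} option"
  shows "paley_conference_mat e \<in> carrier_mat (CARD('a) + 1) (CARD('a) + 1)"
  by (simp add: paley_conference_mat_def)

text \<open>Carries the cyclic form over to an arbitrary enumeration: \<open>idx i\<close> is the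
  position of the i-th point.\<close>

lemma paley_conference_mat_cyclic:
  fixes e :: "nat \<Rightarrow> 'a :: {field, finite} option"
  assumes odd: "odd CARD('a)" and e: "bij_betw e {..<CARD('a) + 1} UNIV"
  obtains idx :: "nat \<Rightarrow> nat" and t :: "nat \<Rightarrow> complex" and s :: "nat \<Rightarrow> nat \<Rightarrow> complex"
  where "inj_on idx {..<CARD('a) + 1}" and "\<And>i. idx i < CARD('a) + 1"
    and "\<And>i. t i = 1 \<or> t i = - 1"
    and "\<And>i j. s (Suc i) (Suc j) = - s i j"
    and "\<And>i j. s i (j + (CARD('a) + 1)) = - s i j"
    and "\<And>i j. paley_conference_mat e $$ (idx i, idx j) = t i * t j * s i j"
proof -
  show ?thesis
  proof (rule paley_conference_cyclic[OF odd])
    fix pt :: "nat \<Rightarrow> 'a option" and t s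
    assume pt: "bij_betw pt {..<CARD('a) + 1} UNIV"
      and ts: "\<And>i. t i = 1 \<or> t i = - 1"
        "\<And>i j. s (Suc i) (Suc j) = - s i j" "\<And>i j. s i (j + (CARD('a) + 1)) = - s i j"
      and entry: "\<And>i j. paley_conference_entry (pt i) (pt j) = t i * t j * s i j"
    define idx where "idx i = inv_into {..<CARD('a) + 1} e (pt i)" for i
    have e_idx: "e (idx i) = pt i" for i
      unfolding idx_def by (rule f_inv_into_f) (use e in \<open>auto simp: bij_betw_def\<close>)
    have idx_less: "idx i < CARD('a) + 1" for i
      using inv_into_into[of "pt i" e "{..<CARD('a) + 1}"] e by (simp add: idx_def bij_betw_def)
    have inj: "inj_on idx {..<CARD('a) + 1}"
      using bij_betw_imp_inj_on[OF pt] unfolding inj_on_def by (metis e_idx)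
    have mat: "paley_conference_mat e $$ (idx i, idx j) = t i * t j * s i j" for i j
      using idx_less[of i] idx_less[of j] by (simp add: paley_conference_mat_def e_idx entry)
    show thesis
      by (rule that[of idx t s]) (fact inj idx_less ts mat)+
  qed
qed

lemma cis_pi_power: "d > 0 \<Longrightarrow> cis (pi / real d) ^ d = - 1"
  by (simp add: DeMoivre)

text \<open>The halves are the even and the odd powers of the generator. Shifting by two preserves
  \<open>s\<close>, so the blocks are shift invariant; shifting by one negates it, so the diagonal
  blocks are opposite.\<close>

lemma type_G_plus_1_equivalent:
  assumes odd: "odd CARD('a :: {field, finite})" and G: "etf_type_G_plus_1 TYPE('a) \<Phi>"
  shows "equivalent_to_2circulant_etf ((CARD('a) + 1) div 2) \<Phi>"
proof -
  define d where "d = (CARD('a) + 1) div 2"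
  have q: "CARD('a) + 1 = 2 * d"
    using odd by (simp add: d_def)
  then have d: "d > 0"
    by (cases d) auto
  from G obtain e :: "nat \<Rightarrow> 'a option" and k where e: "bij_betw e {..<CARD('a) + 1} UNIV"
    and etf: "is_etf d (2 * d) \<Phi>" and sig: "has_signature d (2 * d) \<Phi> (k \<cdot>\<^sub>m paley_conference_mat e)"
    unfolding etf_type_G_plus_1_def Let_def d_def[symmetric] unfolding q by blast
  show ?thesis
  proof (rule paley_conference_mat_cyclic[OF odd e, unfolded q])
    fix idx :: "nat \<Rightarrow> nat" and t s
    assume inj: "inj_on idx {..<2 * d}"
      and idx_less: "\<And>i. idx i < 2 * d" and t: "\<And>i. t i = 1 \<or> t i = - 1"
      and s_Suc: "\<And>i j. s (Suc i) (Suc j) = - s i j"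
      and s_period: "\<And>i j. s i (j + (2 * d)) = - s i j"
      and entry: "\<And>i j. paley_conference_mat e $$ (idx i, idx j) = t i * t j * s i j"
    have idx_eq: "idx i = idx j \<longleftrightarrow> i = j" if "i < 2 * d" "j < 2 * d" for i j
      using inj that by (auto simp: inj_on_def)
    have smult_entry: "(k \<cdot>\<^sub>m paley_conference_mat e) $$ (idx i, idx j) = k * (t i * t j * s i j)" for i j
      using idx_less[of i] idx_less[of j] paley_conference_mat_carrier[of e, unfolded q]
      by (simp add: entry[symmetric])
    \<comment> \<open>Going once around an orbit negates \<open>s\<close>;
      \<open>z ^ d = - 1\<close> compensates, while \<open>cnj (z ^ i) * z ^ j\<close> is invariant
      under a common shift.\<close>
    define z where "z = cis (pi / real d)"
    have z: "cnj z * z = 1" "z ^ d = - 1" "cmod z = 1"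
      using cis_pi_power[OF d] by (simp_all add: z_def cis_cnj cis_mult)
    \<comment> \<open>The signs \<open>t\<close> in the weights cancel those in the entries.\<close>
    have tt: "cnj (t i * x) * (t j * y) * (k * (t i * t j * w)) = k * (cnj x * y * w)" for i j x y w
      using t[of i] t[of j] by auto
    show ?thesis
      unfolding d_def[symmetric]
    proof (rule equivalent_to_2circulant_etfI[OF d etf sig, of "\<lambda>i. idx (2 * i)" "\<lambda>i. idx (2 * i + 1)"
          "\<lambda>i. t (2 * i) * z ^ i" "\<lambda>i. t (2 * i + 1) * z ^ i"
          "\<lambda>i j. k * (cnj (z ^ i) * z ^ j * s (2 * i) (2 * j))"
          "\<lambda>i j. k * (cnj (z ^ i) * z ^ j * s (2 * i) (2 * j + 1))"])
      show "inj_on (\<lambda>i. idx (2 * i)) {..<d}" "inj_on (\<lambda>i. idx (2 * i + 1)) {..<d}"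
        by (auto simp: inj_on_def idx_eq)
      show "(\<lambda>i. idx (2 * i)) ` {..<d} \<subseteq> {..<2 * d}" "(\<lambda>i. idx (2 * i + 1)) ` {..<d} \<subseteq> {..<2 * d}"
        using idx_less by auto
      have "2 * i \<noteq> 2 * j + 1" for i j :: nat
        by presburger
      then show "(\<lambda>i. idx (2 * i)) ` {..<d} \<inter> (\<lambda>i. idx (2 * i + 1)) ` {..<d} = {}"
        by (auto simp: idx_eq)
      show "cmod (t (2 * i) * z ^ i) = 1" "cmod (t (2 * i + 1) * z ^ i) = 1" for i
        using t[of "2 * i"] t[of "2 * i + 1"] z by (auto simp: norm_mult norm_power)
      have zz: "cnj (z ^ Suc i) * z ^ Suc j = cnj (z ^ i) * z ^ j" for i j
      proof -
        have "cnj (z ^ Suc i) * z ^ Suc j = cnj (z ^ i) * z ^ j * (cnj z * z)"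
          by simp
        then show ?thesis
          by (simp only: z mult_1_right)
      qed
      have zd: "z ^ (j + d) = - (z ^ j)" for j
        by (simp add: power_add z)
      have "s (2 * Suc i) (2 * Suc j) = s (2 * i) (2 * j)"
        "s (2 * Suc i) (2 * Suc j + 1) = s (2 * i) (2 * j + 1)"
        "s (2 * i) (2 * (j + d)) = - s (2 * i) (2 * j)"
        "s (2 * i) (2 * (j + d) + 1) = - s (2 * i) (2 * j + 1)" for i j
        using s_period[of "2 * i" "2 * j"] s_period[of "2 * i" "2 * j + 1"] by (simp_all add: s_Suc)
      note s_shift = this
      show "circulant_fun d (\<lambda>i j. k * (cnj (z ^ i) * z ^ j * s (2 * i) (2 * j)))"
        "circulant_fun d (\<lambda>i j. k * (cnj (z ^ i) * z ^ j * s (2 * i) (2 * j + 1)))"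
        unfolding circulant_fun_def zz zd s_shift by simp_all
      fix i j
      show "cnj (t (2 * i) * z ^ i) * (t (2 * j) * z ^ j) * (k \<cdot>\<^sub>m paley_conference_mat e) $$ (idx (2 * i), idx (2 * j))
          = k * (cnj (z ^ i) * z ^ j * s (2 * i) (2 * j))"
        unfolding smult_entry tt ..
      show "cnj (t (2 * i) * z ^ i) * (t (2 * j + 1) * z ^ j) * (k \<cdot>\<^sub>m paley_conference_mat e) $$ (idx (2 * i), idx (2 * j + 1))
          = k * (cnj (z ^ i) * z ^ j * s (2 * i) (2 * j + 1))"
        unfolding smult_entry tt ..
      show "cnj (t (2 * i + 1) * z ^ i) * (t (2 * j + 1) * z ^ j) * (k \<cdot>\<^sub>m paley_conference_mat e) $$ (idx (2 * i + 1), idx (2 * j + 1))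
          = - (k * (cnj (z ^ i) * z ^ j * s (2 * i) (2 * j)))"
        unfolding smult_entry tt by (simp add: s_Suc)
    qed
  qed
qed

text \<open>Type 2 (G_q + 1) only gives \<open>S\<close> as a signature of a frame of type G_q + 1;
  this identifies it with the Paley one. The modulus is read off the Gram entry
  \<open>(0, 1)\<close>, hence \<open>n \<ge> 2\<close>.\<close>

lemma has_signature_unique:
  assumes S: "has_signature d n \<Phi> S" and S': "has_signature d n \<Phi> S'" and n: "n \<ge> 2"
  shows "S = S'"
proof -
  let ?G = "mat_adjoint \<Phi> * \<Phi>"
  from S obtain \<gamma> where \<gamma>: "\<gamma> > 0" "\<forall>i<n. \<forall>j<n. i \<noteq> j \<longrightarrow> cmod (?G $$ (i, j)) = \<gamma>"
      "?G = 1\<^sub>m n + complex_of_real \<gamma> \<cdot>\<^sub>m S" and cS: "S \<in> carrier_mat n n"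
    unfolding has_signature_def by blast
  from S' obtain \<gamma>' where \<gamma>': "\<gamma>' > 0" "\<forall>i<n. \<forall>j<n. i \<noteq> j \<longrightarrow> cmod (?G $$ (i, j)) = \<gamma>'"
      "?G = 1\<^sub>m n + complex_of_real \<gamma>' \<cdot>\<^sub>m S'" and cS': "S' \<in> carrier_mat n n"
    unfolding has_signature_def by blast
  have "cmod (?G $$ (0, 1)) = \<gamma>" "cmod (?G $$ (0, 1)) = \<gamma>'"
    using \<gamma>(2)[rule_format, of 0 1] \<gamma>'(2)[rule_format, of 0 1] n by (simp_all del: index_mult_mat)
  then have "\<gamma> = \<gamma>'"
    by simp
  with \<gamma>(3) \<gamma>'(3) have eq: "1\<^sub>m n + complex_of_real \<gamma> \<cdot>\<^sub>m S = 1\<^sub>m n + complex_of_real \<gamma> \<cdot>\<^sub>m S'"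
    by simp
  show ?thesis
  proof (rule eq_matI)
    fix i j assume "i < dim_row S'" "j < dim_col S'"
    then have ij: "i < n" "j < n"
      using cS' by auto
    have "(1\<^sub>m n + complex_of_real \<gamma> \<cdot>\<^sub>m S) $$ (i, j) = (1\<^sub>m n + complex_of_real \<gamma> \<cdot>\<^sub>m S') $$ (i, j)"
      by (simp only: eq)
    then show "S $$ (i, j) = S' $$ (i, j)"
      using cS cS' ij \<gamma>(1) by simp
  qed (use cS cS' in auto)
qed


lemma type_2_G_mod1_equivalent:
  assumes prime: "prime CARD('a :: {field, finite})" and G: "etf_type_2_G_mod1 TYPE('a) \<Phi>"
  shows "equivalent_to_2circulant_etf CARD('a) \<Phi>"
proof -
  let ?q = "CARD('a)"
  from G obtain e :: "nat \<Rightarrow> 'a" and \<epsilon> :: real and \<beta> where e: "bij_betw e {..<?q} UNIV"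
    and etf: "is_etf ?q (2 * ?q) \<Phi>"
    and sig: "has_signature ?q (2 * ?q) \<Phi> (four_block_mat
        (paley_adjacency_mat e - (ones_mat ?q - 1\<^sub>m ?q - paley_adjacency_mat e))
        (complex_of_real \<epsilon> \<cdot>\<^sub>m 1\<^sub>m ?q + \<beta> \<cdot>\<^sub>m paley_adjacency_mat e
          + cnj \<beta> \<cdot>\<^sub>m (ones_mat ?q - 1\<^sub>m ?q - paley_adjacency_mat e))
        (complex_of_real \<epsilon> \<cdot>\<^sub>m 1\<^sub>m ?q + cnj \<beta> \<cdot>\<^sub>m paley_adjacency_mat e
          + \<beta> \<cdot>\<^sub>m (ones_mat ?q - 1\<^sub>m ?q - paley_adjacency_mat e))
        ((ones_mat ?q - 1\<^sub>m ?q - paley_adjacency_mat e) - paley_adjacency_mat e))"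
    unfolding etf_type_2_G_mod1_def Let_def by blast
  \<comment> \<open>The blocks \<open>A\<close> and \<open>B = J - I - A\<close> as functions of the
    difference of two field elements. The value of \<open>\<beta>\<close> stays arbitrary.\<close>
  define a :: "'a \<Rightarrow> complex" where "a x = (if quad_char x = 1 then 1 else 0)" for x
  define b :: "'a \<Rightarrow> complex" where "b x = 1 - (if x = 0 then 1 else 0) - a x" for x
  have eq: "e i = e j \<longleftrightarrow> i = j" if "i < ?q" "j < ?q" for i j
    using e that by (auto simp: bij_betw_def inj_on_def)
  have dims: "dim_row (paley_adjacency_mat e) = ?q" "dim_col (paley_adjacency_mat e) = ?q"
      "dim_row (ones_mat ?q) = ?q" "dim_col (ones_mat ?q) = ?q"
    by (simp_all add: paley_adjacency_mat_def ones_mat_def)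
  have entry: "paley_adjacency_mat e $$ (i, j) = a (e i - e j)" "ones_mat ?q $$ (i, j) = 1"
    if "i < ?q" "j < ?q" for i j
    using that by (simp_all add: paley_adjacency_mat_def ones_mat_def a_def)
  show ?thesis
    by (rule type_2_G_equivalent[OF prime refl e etf sig, of "\<lambda>x. a x - b x"
          "\<lambda>x. complex_of_real \<epsilon> * (if x = 0 then 1 else 0) + \<beta> * a x + cnj \<beta> * b x"])
       (auto intro!: carrier_matI simp: dims entry b_def eq)
qed

lemma type_2_G_mod3_equivalent:
  assumes prime: "prime CARD('a :: {field, finite})" and G: "etf_type_2_G_mod3 TYPE('a) \<Phi>"
  shows "equivalent_to_2circulant_etf CARD('a) \<Phi>"
proof -
  let ?q = "CARD('a)"
  from G obtain e :: "nat \<Rightarrow> 'a" and \<sigma> :: real and \<beta> where e: "bij_betw e {..<?q} UNIV"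
    and etf: "is_etf ?q (2 * ?q) \<Phi>"
    and sig: "has_signature ?q (2 * ?q) \<Phi> (four_block_mat
        (complex_of_real \<sigma> \<cdot>\<^sub>m renes_strohmer_mat e)
        (complex_of_real \<sigma> \<cdot>\<^sub>m renes_strohmer_mat e + \<beta> \<cdot>\<^sub>m 1\<^sub>m ?q)
        (complex_of_real \<sigma> \<cdot>\<^sub>m renes_strohmer_mat e + cnj \<beta> \<cdot>\<^sub>m 1\<^sub>m ?q)
        (- (complex_of_real \<sigma> \<cdot>\<^sub>m renes_strohmer_mat e)))"
    unfolding etf_type_2_G_mod3_def Let_def by blast
  define f :: "'a \<Rightarrow> complex" where
    "f x = complex_of_real \<sigma> * (complex_of_real (1 / sqrt (real ?q + 1)) *
      (\<i> * complex_of_real (sqrt (real ?q)) * quad_char x + 1 - (if x = 0 then 1 else 0)))" for x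
  have eq: "e i = e j \<longleftrightarrow> i = j" if "i < ?q" "j < ?q" for i j
    using e that by (auto simp: bij_betw_def inj_on_def)
  have dims: "dim_row (renes_strohmer_mat e) = ?q" "dim_col (renes_strohmer_mat e) = ?q"
    by (simp_all add: renes_strohmer_mat_def Let_def paley_char_mat_def ones_mat_def)
  have entry: "complex_of_real \<sigma> * renes_strohmer_mat e $$ (i, j) = f (e i - e j)" if "i < ?q" "j < ?q" for i j
    using that by (simp add: renes_strohmer_mat_def Let_def paley_char_mat_def ones_mat_def f_def eq)
  show ?thesis
    by (rule type_2_G_equivalent[OF prime refl e etf sig, of f "\<lambda>x. f x + \<beta> * (if x = 0 then 1 else 0)"])
       (auto intro!: carrier_matI simp: dims eq simp flip: entry)
qed

text \<open>Shifting the powers \<open>w\<^sup>i\<close> of the generator negates \<open>S\<close>, which is undone by exchanging the two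
  copies of the projective line. So the two cyclic orbits take the points \<open>w\<^sup>i\<close> alternately from
  the two copies; \<open>\<kappa>\<close> has the sign pattern \<open>+ + - -\<close>, and \<open>z\<close> makes the weights periodic.\<close>

lemma type_2_G_plus_1_equivalent:
  assumes odd: "odd CARD('a :: {field, finite})" and G: "etf_type_2_G_plus_1 TYPE('a) \<Phi>"
  shows "equivalent_to_2circulant_etf (CARD('a) + 1) \<Phi>"
proof -
  define m where "m = CARD('a) + 1"
  obtain h where h: "m = 2 * h"
    using odd unfolding m_def by (metis evenE even_plus_one_iff)
  have m: "m > 0" "h > 0"
    using h by (auto simp: m_def)
  from G obtain \<Phi>\<^sub>0 S where etf: "is_etf m (2 * m) \<Phi>" and G\<^sub>0: "etf_type_G_plus_1 TYPE('a) \<Phi>\<^sub>0"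
    and S: "has_signature (m div 2) m \<Phi>\<^sub>0 S"
    and sig: "has_signature m (2 * m) \<Phi>
      (four_block_mat S (S + \<i> \<cdot>\<^sub>m 1\<^sub>m m) (S - \<i> \<cdot>\<^sub>m 1\<^sub>m m) (- S))"
    unfolding etf_type_2_G_plus_1_def Let_def m_def by blast
  from G\<^sub>0 obtain e :: "nat \<Rightarrow> 'a option" and k where e: "bij_betw e {..<CARD('a) + 1} UNIV"
    and S': "has_signature (m div 2) m \<Phi>\<^sub>0 (k \<cdot>\<^sub>m paley_conference_mat e)"
    unfolding etf_type_G_plus_1_def Let_def m_def by blast
  have S_eq: "S = k \<cdot>\<^sub>m paley_conference_mat e"
    using has_signature_unique[OF S S'] m h by simp
  have cS: "S \<in> carrier_mat m m"
    using S by (simp add: has_signature_def)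
  show ?thesis
    unfolding m_def[symmetric]
  proof (rule paley_conference_mat_cyclic[OF odd e, folded m_def])
    fix idx :: "nat \<Rightarrow> nat" and t s
    assume inj: "inj_on idx {..<m}"
      and idx_less: "\<And>i. idx i < m" and t: "\<And>i. t i = 1 \<or> t i = - 1"
      and s_Suc: "\<And>i j. s (Suc i) (Suc j) = - s i j"
      and s_period: "\<And>i j. s i (j + m) = - s i j"
      and entry: "\<And>i j. paley_conference_mat e $$ (idx i, idx j) = t i * t j * s i j"
    have idx_eq: "idx i = idx j \<longleftrightarrow> i = j" if "i < m" "j < m" for i j
      using inj that by (auto simp: inj_on_def)
    have S_entry: "S $$ (idx i, idx j) = k * (t i * t j * s i j)" for i j
      using idx_less[of i] idx_less[of j] paley_conference_mat_carrier[of e, folded m_def]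
      by (simp add: S_eq entry[symmetric])
    \<comment> \<open>A shift by \<open>m = 2 * h\<close> contributes -1 through \<open>s\<close>
      and \<open>(- 1) ^ h\<close> through \<open>\<kappa>\<close>, so \<open>z ^ m\<close> has to
      equal their product.\<close>
    obtain z where z: "cnj z * z = 1" "z ^ m = - ((- 1) ^ h)" "cmod z = 1"
    proof (cases "even h")
      case True
      show ?thesis
        by (rule that[of "cis (pi / real m)"]) (use True cis_pi_power[OF m(1)] in \<open>simp_all add: cis_cnj cis_mult\<close>)
    next
      case False
      show ?thesis
        by (rule that[of 1]) (use False in simp_all)
    qed
    define \<kappa> :: "nat \<Rightarrow> complex" where "\<kappa> i = (- 1) ^ (i div 2)" for i
    have \<kappa>_Suc: "\<kappa> (Suc i) = (if even i then \<kappa> i else - \<kappa> i)" for i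
      by (auto simp: \<kappa>_def elim!: evenE oddE)
    have \<kappa>_period: "\<kappa> (j + m) = (- 1) ^ h * \<kappa> j" for j
      by (simp add: \<kappa>_def h power_add)
    have \<kappa>: "cnj (\<kappa> i) = \<kappa> i" "\<kappa> i * \<kappa> i = 1" "cmod (\<kappa> i) = 1" for i
      by (simp_all add: \<kappa>_def norm_power flip: power_mult_distrib)
    have even_m: "even m"
      by (simp add: h)
    have m1: "(- 1) ^ (j + m) = (- 1 :: complex) ^ j" for j
      by (simp add: h power_add)
    \<comment> \<open>The conditional signs mark the pairs whose points both lie in the second copy,
      where the block is \<open>- S\<close>: both indices odd for \<open>p\<close> with
      \<open>p\<close>, odd with even for \<open>p\<close> with \<open>r\<close>. The factor
      \<open>(- 1) ^ j\<close> in \<open>b\<close> is the extra weight on the \<open>r\<close>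
      side.\<close>
    define a where "a i j = \<kappa> i * \<kappa> j * (if odd i \<and> odd j then - 1 else 1) * s i j" for i j
    define b where "b i j = \<kappa> i * \<kappa> j * (- 1) ^ j * (if odd i \<and> even j then - 1 else 1) * s i j" for i j
    have a: "a (Suc i) (Suc j) = a i j" "a i (j + m) = - ((- 1) ^ h) * a i j"
      and b: "b (Suc i) (Suc j) = b i j" "b i (j + m) = - ((- 1) ^ h) * b i j" for i j
      using even_m m1 by (auto simp: a_def b_def \<kappa>_Suc \<kappa>_period s_Suc s_period)
    have zz: "cnj (z ^ Suc i) * z ^ Suc j = cnj (z ^ i) * z ^ j" for i j
    proof -
      have "cnj (z ^ Suc i) * z ^ Suc j = cnj (z ^ i) * z ^ j * (cnj z * z)"
        by simp
      then show ?thesis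
        by (simp only: z mult_1_right)
    qed
    have zm: "z ^ (j + m) = - ((- 1) ^ h) * z ^ j" for j
      by (simp add: power_add z)
    have sq: "((- 1) ^ h) * ((- 1) ^ h * x) = x" for x :: complex
      by (simp add: mult.assoc[symmetric] power_add[symmetric])
    define A where "A i j = k * (cnj (z ^ i) * z ^ j * a i j)" for i j
    define B where "B i j = k * (cnj (z ^ i) * z ^ j * b i j) + \<i> * (if i mod m = j mod m then 1 else 0)" for i j
    have A: "circulant_fun m A"
      unfolding circulant_fun_def A_def zz zm a using sq by (simp add: mult_ac)
    have B: "circulant_fun m B"
      unfolding circulant_fun_def B_def zz zm b using sq by (simp add: mult_ac mod_Suc)
    define p where "p i = idx i + (if even i then 0 else m)" for i
    \<comment> \<open>The extra factor \<open>(- 1) ^ i\<close> given to the weights of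
      \<open>r\<close> below makes its diagonal block exactly the negative of that of
      \<open>p\<close>.\<close>
    define r where "r i = idx i + (if even i then m else 0)" for i
    have tt: "cnj (t i * x) * (t j * y) * (c * (k * (t i * t j * w))) = k * (cnj x * y * c * w)" for i j x y w c
      using t[of i] t[of j] by auto
    show "equivalent_to_2circulant_etf m \<Phi>"
    proof (rule equivalent_to_2circulant_etfI[OF m(1) etf sig, of p r
          "\<lambda>i. t i * (\<kappa> i * z ^ i)" "\<lambda>i. t i * ((- 1) ^ i * \<kappa> i * z ^ i)" A B])
      have "idx i \<noteq> idx j + m" for i j
        using idx_less[of i] by simp
      note neq = this this[symmetric]
      show "inj_on p {..<m}" "inj_on r {..<m}"
        by (auto simp: inj_on_def p_def r_def idx_eq neq split: if_splits)
      show "p ` {..<m} \<subseteq> {..<2 * m}" "r ` {..<m} \<subseteq> {..<2 * m}"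
        using idx_less by (auto simp: p_def r_def mult_2 trans_less_add1)
      show "p ` {..<m} \<inter> r ` {..<m} = {}"
        by (auto simp: p_def r_def idx_eq neq split: if_splits)
      show "cmod (t i * (\<kappa> i * z ^ i)) = 1" "cmod (t i * ((- 1) ^ i * \<kappa> i * z ^ i)) = 1" for i
        using t[of i] by (auto simp: norm_mult norm_power z \<kappa>)
      show "circulant_fun m A" "circulant_fun m B"
        by (rule A B)+
      let ?M = "four_block_mat S (S + \<i> \<cdot>\<^sub>m 1\<^sub>m m) (S - \<i> \<cdot>\<^sub>m 1\<^sub>m m) (- S)"
      fix i j assume ij: "i < m" "j < m"
      note [simp] = idx_less trans_less_add1[OF idx_less] idx_eq[OF ij] carrier_matD[OF cS]
      have "?M $$ (p i, p j) = (if odd i \<and> odd j then - 1 else 1) * S $$ (idx i, idx j)"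
        by (auto simp: p_def)
      then show "cnj (t i * (\<kappa> i * z ^ i)) * (t j * (\<kappa> j * z ^ j)) * ?M $$ (p i, p j) = A i j"
        unfolding S_entry by (simp only: tt) (simp add: A_def a_def \<kappa> mult_ac)
      have "?M $$ (r i, r j) = (if even i \<and> even j then - 1 else 1) * S $$ (idx i, idx j)"
        by (auto simp: r_def)
      then show "cnj (t i * ((- 1) ^ i * \<kappa> i * z ^ i)) * (t j * ((- 1) ^ j * \<kappa> j * z ^ j)) * ?M $$ (r i, r j) = - A i j"
        unfolding S_entry by (simp only: tt) (auto simp: A_def a_def \<kappa>)
      have *: "?M $$ (p i, r j) = (if odd i \<and> even j then - 1 else 1) * S $$ (idx i, idx j)
          + (if i = j then (- 1) ^ i * \<i> else 0)"
        by (auto simp: p_def r_def)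
      \<comment> \<open>The points \<open>p i\<close> and \<open>r i\<close> are the two copies of
        one point, in an order alternating with the parity of \<open>i\<close>, so the identity
        terms contribute alternately \<i> and -\<i>. The factor \<open>(- 1) ^ i\<close> in the
        weight of \<open>r\<close> makes them all \<i>.\<close>
      have tz: "cnj (t i * (\<kappa> i * z ^ i)) * (t i * ((- 1) ^ i * \<kappa> i * z ^ i)) * ((- 1) ^ i * \<i>) = \<i>"
      proof -
        have "cnj (t i * (\<kappa> i * z ^ i)) * (t i * ((- 1) ^ i * \<kappa> i * z ^ i)) * ((- 1) ^ i * \<i>)
          = (cnj (t i) * t i) * (\<kappa> i * \<kappa> i) * (cnj z * z) ^ i * ((- 1) * (- 1)) ^ i * \<i>"
          by (simp add: \<kappa>(1) power_mult_distrib mult_ac flip: power_add)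
        then show ?thesis
          using t[of i] by (auto simp: \<kappa> z)
      qed
      have "cnj (t i * (\<kappa> i * z ^ i)) * (t j * ((- 1) ^ j * \<kappa> j * z ^ j)) * ?M $$ (p i, r j)
         = k * (cnj (\<kappa> i * z ^ i) * ((- 1) ^ j * \<kappa> j * z ^ j) * (if odd i \<and> even j then - 1 else 1) * s i j)
         + (if i = j then \<i> else 0)"
        unfolding * S_entry distrib_left tt using tz by auto
      then show "cnj (t i * (\<kappa> i * z ^ i)) * (t j * ((- 1) ^ j * \<kappa> j * z ^ j)) * ?M $$ (p i, r j) = B i j"
        using ij by (simp add: B_def b_def \<kappa> mult_ac)
    qed
  qed
qed

theorem theorem28:
  fixes q :: nat
  assumes "CARD('a :: {field, finite}) = q" and "odd q"
  shows "(\<forall>\<Phi>. etf_type_G_plus_1 TYPE('a) \<Phi> \<longrightarrow> equivalent_to_2circulant_etf ((q + 1) div 2) \<Phi>) \<and>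
         (prime q \<longrightarrow> (\<forall>\<Phi>. etf_type_2_G TYPE('a) \<Phi> \<longrightarrow> equivalent_to_2circulant_etf q \<Phi>)) \<and>
         (\<forall>\<Phi>. etf_type_2_G_plus_1 TYPE('a) \<Phi> \<longrightarrow> equivalent_to_2circulant_etf (q + 1) \<Phi>)"
  using assms type_G_plus_1_equivalent type_2_G_plus_1_equivalent
    type_2_G_mod1_equivalent type_2_G_mod3_equivalent
  unfolding etf_type_2_G_def by blast

end
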